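(* The average area of uniformly random extended fighting fish of size $n$ has the following asymptotic behavior as $n\to\infty$: $$\frac{\sum_{F\in\mathcal{EF}_n}\mathrm{area}(F)}{|\mathcal{EF}_n|}=\frac{[t^n]A(t)}{[t^n]H(t)}\sim\frac{2^{1/4}\,3^{3/4}\sqrt{\pi}}{2\,\Gamma(\frac34)}\;n^{5/4},$$ where $H(t)=\sum_{n\ge1}|\mathcal{EF}_n|\,t^n$ and $A(t)=\sum_{n\ge1}\Big(\sum_{F\in\mathcal{EF}_n}\mathrm{area}(F)\Big)t^n$.
   Context: Fighting fish are the words on $\{E,N,W,S\}$ obtainable from $ENWS$ by finitely many operations of the form: replace a factor (contiguous subword) $W$ by $NWS$; replace a factor $N$ by $ENW$; replace a factor $WN$ by $NW$. Extended fighting fish are the words on $\{E,N,W,S,V\}$ obtained from a fighting fish by choosing a (possibly empty) set of occurrences of the factor $WN$ and replacing each chosen one by the letter $V$. (There is also one special "empty" fish of size $0$, irrelevant here.) With $|F|_X$ the number of letters $X$ in $F$: $\mathrm{size}(F)=|F|_E+|F|_N-1$, and $\mathcal{EF}_n$ is the set of extended fighting fish of size $n$. The area (number of cells) is $\mathrm{area}(F)=\sum_{k=1}^m(\mathrm{lat}(F^{\le k})-\mathrm{lat}(F^{\le k-1}))\,\mathrm{long}(F^{\le k})$, where $m$ is the length of the word $F$, $F^{\le k}$ its prefix of length $k$, $\mathrm{lat}(w)=|w|_N-|w|_S+|w|_V$ and $\mathrm{long}(w)=|w|_E-|w|_W-|w|_V$. *)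

theory Defs
  imports
    "HOL-Analysis.Analysis"
    "HOL-Computational_Algebra.Formal_Power_Series"
    "HOL-Library.Landau_Symbols"
begin

datatype letter = E | N | W | S | V

inductive fighting_fish :: "letter list \<Rightarrow> bool" where
  cell: "fighting_fish [E, N, W, S]"
| glue_W: "fighting_fish (u @ [W] @ v) \<Longrightarrow> fighting_fish (u @ [N, W, S] @ v)"
| glue_N: "fighting_fish (u @ [N] @ v) \<Longrightarrow> fighting_fish (u @ [E, N, W] @ v)"
| glue_WN: "fighting_fish (u @ [W, N] @ v) \<Longrightarrow> fighting_fish (u @ [N, W] @ v)"

definition WN_occs :: "letter list \<Rightarrow> nat set" where
  "WN_occs F = {i. i + 1 < length F \<and> F ! i = W \<and> F ! (i + 1) = N}"

(* For i in I, position i is replaced by V and position i + 1 is deleted. This is only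
   meant for I a subset of WN_occs F; distinct occurrences of WN never overlap. *)
definition contract :: "nat set \<Rightarrow> letter list \<Rightarrow> letter list" where
  "contract I F =
     concat (map (\<lambda>i. if i \<in> I then [V] else if 0 < i \<and> i - 1 \<in> I then [] else [F ! i])
       [0..<length F])"

definition extended_fighting_fish :: "letter list \<Rightarrow> bool" where
  "extended_fighting_fish G \<longleftrightarrow>
     (\<exists>F I. fighting_fish F \<and> I \<subseteq> WN_occs F \<and> G = contract I F)"

(* The letter V does not contribute. The subtraction does not truncate on
   extended fighting fish, which all contain an E. *)
definition fish_size :: "letter list \<Rightarrow> nat" where
  "fish_size F = count_list F E + count_list F N - 1"

definition EF :: "nat \<Rightarrow> letter list set" where
  "EF n = {F. extended_fighting_fish F \<and> fish_size F = n}"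

definition lat :: "letter list \<Rightarrow> int" where
  "lat w = int (count_list w N) - int (count_list w S) + int (count_list w V)"

definition long :: "letter list \<Rightarrow> int" where
  "long w = int (count_list w E) - int (count_list w W) - int (count_list w V)"

definition area :: "letter list \<Rightarrow> int" where
  "area F = (\<Sum>k = 1..length F. (lat (take k F) - lat (take (k - 1) F)) * long (take k F))"

definition fish_gf :: "real fps" where
  "fish_gf = Abs_fps (\<lambda>n. if n = 0 then 0 else real (card (EF n)))"

definition area_gf :: "real fps" where
  "area_gf = Abs_fps (\<lambda>n. if n = 0 then 0 else (\<Sum>F\<in>EF n. real_of_int (area F)))"


(* The sets EF n are finite, and nonempty for n \<ge> 1, so that the averages
   over them are meaningful. *)

fun expand :: "letter list \<Rightarrow> letter list" where
  "expand [] = []"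
| "expand (x # xs) = (if x = V then [W, N] else [x]) @ expand xs"

lemma expand_append [simp]: "expand (xs @ ys) = expand xs @ expand ys"
  by (induction xs) auto

lemma fighting_fish_counts:
  "fighting_fish F \<Longrightarrow>
     count_list F E = count_list F W \<and> count_list F N = count_list F S \<and>
     count_list F V = 0 \<and> 0 < count_list F E"
  by (induction rule: fighting_fish.induct) auto

lemma expand_contract_upt:
  assumes "V \<notin> set F" "I \<subseteq> WN_occs F" "k \<le> length F"
  shows "expand (concat (map (\<lambda>i. if i \<in> I then [V] else if 0 < i \<and> i - 1 \<in> I then [] else [F ! i]) [0..<k]))
    = (if 0 < k \<and> k - 1 \<in> I then take (k + 1) F else take k F)"
  using assms(3)
proof (induction k)
  case (Suc k)
  have occ: "Suc i < length F \<and> F ! i = W \<and> F ! Suc i = N" if "i \<in> I" for i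
    using assms(2) that by (auto simp: WN_occs_def)
  have nV: "F ! k \<noteq> V"
    using assms(1) Suc.prems by (metis Suc_le_lessD nth_mem)
  define g where
    "g = (\<lambda>i. if i \<in> I then [V] else if 0 < i \<and> i - 1 \<in> I then [] else [F ! i])"
  have step: "expand (concat (map g [0..<Suc k])) = expand (concat (map g [0..<k])) @ expand (g k)"
    by simp
  have IH: "expand (concat (map g [0..<k])) = (if 0 < k \<and> k - 1 \<in> I then take (k + 1) F else take k F)"
    using Suc unfolding g_def by simp
  have k: "take (Suc k) F = take k F @ [F ! k]"
    using Suc.prems by (simp add: take_Suc_conv_app_nth)
  have "expand (concat (map g [0..<Suc k])) = (if k \<in> I then take (Suc k + 1) F else take (Suc k) F)"
  proof (cases "k \<in> I")
    case True
    have "\<not> (0 < k \<and> k - 1 \<in> I)"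
      using True occ[of "k - 1"] occ[of k] by auto
    moreover have "take (Suc k + 1) F = take k F @ [W, N]"
      using occ[OF True] by (simp add: take_Suc_conv_app_nth)
    ultimately show ?thesis
      using True unfolding step IH by (auto simp: g_def)
  next
    case False
    then show ?thesis
      using nV unfolding step IH using k by (cases "k = 0") (simp_all add: g_def)
  qed
  then show ?case
    by (simp add: g_def)
qed simp

lemma expand_contract:
  assumes "V \<notin> set F" "I \<subseteq> WN_occs F"
  shows "expand (contract I F) = F"
  unfolding contract_def
  by (subst expand_contract_upt[OF assms]) auto

lemma contract_empty [simp]: "contract {} F = F"
proof -
  have "concat (map (\<lambda>x. [f x]) xs) = map f xs" for f :: "nat \<Rightarrow> letter" and xs
    by (induction xs) auto
  then show ?thesis
    by (simp add: contract_def map_nth)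
qed

lemma count_list_expand:
  "count_list (expand F) E = count_list F E"
  "count_list (expand F) N = count_list F N + count_list F V"
  "count_list (expand F) W = count_list F W + count_list F V"
  "count_list (expand F) S = count_list F S"
  by (induction F) auto

lemma length_eq_counts:
  "length F = count_list F E + count_list F N + count_list F W + count_list F S + count_list F V"
proof (induction F)
  case (Cons x F)
  then show ?case by (cases x) auto
qed simp

lemma extended_fighting_fish_expand:
  assumes "extended_fighting_fish G"
  shows "fighting_fish (expand G)"
proof -
  obtain F I where F: "fighting_fish F" "I \<subseteq> WN_occs F" "G = contract I F"
    using assms unfolding extended_fighting_fish_def by blast
  then show ?thesis
    using fighting_fish_counts[OF F(1)] by (simp add: expand_contract count_list_0_iff)
qed

lemma finite_EF: "finite (EF n)"
proof -
  have "finite (UNIV :: letter set)"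
  proof (rule finite_subset)
    show "UNIV \<subseteq> {E, N, W, S, V}"
      by (auto intro: letter.exhaust)
  qed simp
  then have "finite {F :: letter list. set F \<subseteq> UNIV \<and> length F \<le> 3 * n + 3}"
    by (rule finite_lists_length_le)
  moreover have "length F \<le> 3 * n + 3" if "F \<in> EF n" for F
  proof -
    have "fighting_fish (expand F)" and "count_list F E + count_list F N - 1 = n"
      using that extended_fighting_fish_expand by (auto simp: EF_def fish_size_def)
    then show ?thesis
      using fighting_fish_counts[of "expand F"]
      unfolding length_eq_counts[of F] count_list_expand by linarith
  qed
  ultimately show ?thesis
    by (auto intro: finite_subset[rotated])
qed

lemma EF_nonempty:
  assumes "n \<ge> 1"
  shows "EF n \<noteq> {}"
proof -
  have fish: "fighting_fish (E # replicate (Suc k) N @ [W] @ replicate (Suc k) S)" for k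
  proof (induction k)
    case 0
    show ?case using cell by simp
  next
    case (Suc k)
    then have "fighting_fish ((E # replicate (Suc k) N) @ [W] @ replicate (Suc k) S)"
      by simp
    from glue_W[OF this] show ?case
      by (simp add: replicate_app_Cons_same)
  qed
  have count: "count_list (replicate k x) y = (if x = y then k else 0)" for k and x y :: letter
    by (induction k) auto
  obtain k where k: "n = Suc k"
    using assms by (cases n) auto
  let ?F = "E # replicate (Suc k) N @ [W] @ replicate (Suc k) S"
  have "extended_fighting_fish ?F"
    unfolding extended_fighting_fish_def
    using fish[of k] by (intro exI[of _ ?F] exI[of _ "{}"]) (simp del: replicate_Suc)
  moreover have "fish_size ?F = n"
    by (simp add: fish_size_def count k)
  ultimately show ?thesis
    unfolding EF_def by blast
qed

end

theory Submission
  imports Defs "HOL-Real_Asymp.Real_Asymp"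
begin

text \<open>
  Peeling off the bottom row of cells turns an extended fighting fish of size \<open>n\<close> into a labelled binary
  tree with \<open>n\<close> nodes. With \<open>x\<close> marking the width, the generating function of these trees satisfies the
  equation of Tamari intervals,
  \<open>(x - 1) G(x) = (x - 1) + t x G(x) (x G(x) - G(1))\<close>, and weighting by area gives a linear equation with
  the same kernel. At the root \<open>x = Y\<close> of the kernel one finds \<open>G(Y) = Y\<close>, \<open>Y = 1 + t Y^4\<close>,
  \<open>G(1) = 2 Y^2 - Y^3\<close>, and the area generating function \<open>Y^2 G'(Y)\<close>, where \<open>\<delta> = G'(Y)\<close> solves
  \<open>\<delta> = z (1 + \<delta>)^2\<close> with \<open>z = t Y^3\<close>. So \<open>1 + \<delta>\<close> is the Catalan series in \<open>z\<close>, and since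
  \<open>z^m Y^2 = t^m Y^(3m+2)\<close>, the total area is the explicit positive sum
  \<open>\<Sum>m=1..n. Cat m * (3m+2)/(4n-m+2) * ((4n-m+2) choose (n-m))\<close>. Its main contribution comes from
  \<open>m\<close> of order \<open>sqrt n\<close>, where after division by \<open>(4n+2) choose n\<close> it becomes a Riemann sum for
  \<open>v^(-1/2) exp(-3 v^2 / 8)\<close>.
\<close>

section \<open>Fighting fish as boundary words\<close>

text \<open>Gluing may happen anywhere on the boundary, so one fish has many histories. The words
  grown from a straight path \<open>replicate k W\<close> are closed under gluing and parse uniquely
  into rows, which makes the tree independent of the history. The label of a node ranges from 1 to
  one more than the width of the path above its row; summing over it gives a divided difference at x
  = 1, and this is how the unknown G(1) enters the equation. The equation is never solved for G(x).
  Its value and its first two x-derivatives at the kernel root already determine G(Y), G(1) and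
  G'(Y), and the area equation needs nothing else. The explicit sum has no cancellation, so
  dominated convergence suffices for the asymptotics. With m = v sqrt n, a summand divided by (4n+2
  choose n) is about n^(-5/4) * 3/(4 sqrt pi) * v^(-1/2) exp(-3 v^2/8); the spacing 1/sqrt n turns
  n^(-5/4) into n^(-3/4). The number of fish is (4n+2 choose n) / ((2n+1)(n+1)), which contributes 2
  n^2 and hence the exponent 5/4. The integral yields Gamma(1/4), and the reflection formula turns
  it into Gamma(3/4).\<close>

inductive grow :: "letter list \<Rightarrow> letter list \<Rightarrow> bool" where
  grow_W: "grow (W # v) (N # W # S # v)"
| grow_N: "grow (N # v) (E # N # W # v)"
| grow_WN: "grow (W # N # v) (N # W # v)"
| grow_Cons: "grow v v' \<Longrightarrow> grow (a # v) (a # v')"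

lemma grow_append_left: "grow v v' \<Longrightarrow> grow (u @ v) (u @ v')"
  by (induction u) (auto intro: grow_Cons)

lemma grow_append_right: "grow v v' \<Longrightarrow> grow (v @ w) (v' @ w)"
  by (induction rule: grow.induct) (auto intro: grow.intros)

lemma grow_Nil: "\<not> grow [] r"
  by (auto elim: grow.cases)

lemma grow_ConsE:
  assumes "grow (a # v) r"
  obtains "a = W" "r = N # W # S # v" | "a = N" "r = E # N # W # v"
    | v' where "a = W" "v = N # v'" "r = N # W # v'"
    | v' where "grow v v'" "r = a # v'"
  using assms by (cases rule: grow.cases) auto

text \<open>Gluing is local: only the rule for \<open>WN\<close> reads two letters, so a step either
  stays on one side of the cut or absorbs a \<open>WN\<close> straddling it. This lets closure of
  \<open>rim\<close> be checked piece by piece.\<close>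

lemma grow_appendE:
  assumes "grow (xs @ ys) r"
  obtains xs' where "grow xs xs'" "r = xs' @ ys"
    | ys' where "grow ys ys'" "r = xs @ ys'"
    | xs0 ys0 where "xs = xs0 @ [W]" "ys = N # ys0" "r = xs0 @ N # W # ys0"
  using assms
proof (induction xs arbitrary: r thesis)
  case Nil
  then show ?case by auto
next
  case (Cons a xs)
  from Cons.prems(4) have "grow (a # (xs @ ys)) r" by simp
  then show ?case
  proof (cases rule: grow_ConsE)
    case 1
    then show ?thesis using Cons.prems(1)[of "N # W # S # xs"] grow_W by auto
  next
    case 2
    then show ?thesis using Cons.prems(1)[of "E # N # W # xs"] grow_N by auto
  next
    case (3 v')
    show ?thesis
    proof (cases xs)
      case Nil
      then show ?thesis using Cons.prems(3)[of "[]" v'] 3 by auto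
    next
      case (Cons b xs')
      then show ?thesis using Cons.prems(1)[of "N # W # xs'"] 3 grow_WN by auto
    qed
  next
    case (4 v')
    from 4(1) show ?thesis
    proof (rule Cons.IH[rotated 3])
      fix xs' assume "grow xs xs'" "v' = xs' @ ys"
      then show ?thesis using Cons.prems(1)[of "a # xs'"] 4 grow_Cons by auto
    next
      fix ys' assume "grow ys ys'" "v' = xs @ ys'"
      then show ?thesis using Cons.prems(2)[of ys'] 4 by auto
    next
      fix xs0 ys0 assume "xs = xs0 @ [W]" "ys = N # ys0" "v' = xs0 @ N # W # ys0"
      then show ?thesis using Cons.prems(3)[of "a # xs0" ys0] 4 by auto
    qed
  qed
qed

lemma grow_contextE:
  assumes "grow F F'"
  obtains u v where "F = u @ [W] @ v" "F' = u @ [N, W, S] @ v"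
    | u v where "F = u @ [N] @ v" "F' = u @ [E, N, W] @ v"
    | u v where "F = u @ [W, N] @ v" "F' = u @ [N, W] @ v"
proof -
  have "(\<exists>u v. F = u @ [W] @ v \<and> F' = u @ [N, W, S] @ v) \<or>
        (\<exists>u v. F = u @ [N] @ v \<and> F' = u @ [E, N, W] @ v) \<or>
        (\<exists>u v. F = u @ [W, N] @ v \<and> F' = u @ [N, W] @ v)"
    using assms
  proof (induction rule: grow.induct)
    case (grow_W v)
    show ?case by (intro disjI1 exI[of _ "[]"] exI[of _ v]) simp
  next
    case (grow_N v)
    show ?case by (intro disjI2 disjI1 exI[of _ "[]"] exI[of _ v]) simp
  next
    case (grow_WN v)
    show ?case by (intro disjI2 exI[of _ "[]"] exI[of _ v]) simp
  next
    case (grow_Cons v v' a)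
    then show ?case by (metis append_Cons)
  qed
  then show ?thesis using that by blast
qed

lemma fighting_fish_grow: "fighting_fish F \<Longrightarrow> grow F F' \<Longrightarrow> fighting_fish F'"
  by (erule grow_contextE) (auto intro: glue_W[simplified] glue_N[simplified] glue_WN[simplified])

text \<open>
  \<^term>\<open>rim k F\<close>: the words into which a horizontal edge path \<^term>\<open>replicate k W\<close> can grow.
  In \<open>rim_strip\<close>, a row of \<^term>\<open>m\<close> cells is glued below the path \<^term>\<open>z\<close>; it rests
  on \<^term>\<open>c\<close> edges of the original path and sticks out by the remaining ones.
\<close>

inductive rim :: "nat \<Rightarrow> letter list \<Rightarrow> bool" where
  rim_Nil: "rim 0 []"
| rim_W: "rim k x \<Longrightarrow> rim (Suc k) (W # x)"
| rim_strip: "rim m z \<Longrightarrow> rim k x \<Longrightarrow> 1 \<le> c \<Longrightarrow> c \<le> m \<Longrightarrow>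
    rim (c + k) (replicate (m - c) E @ N # z @ S # x)"

text \<open>Each rule modifies rows in one way: gluing to a \<open>W\<close> starts a row over one
  edge, \<open>WN\<close> extends the following row over that edge, and \<open>N\<close> adds a
  protruding cell to its row. Every other step happens inside \<open>z\<close> or
  \<open>x\<close>.\<close>

lemma rim_grow: "rim k F \<Longrightarrow> grow F F' \<Longrightarrow> rim k F'"
proof (induction arbitrary: F' rule: rim.induct)
  case rim_Nil
  then show ?case by (simp add: grow_Nil)
next
  case (rim_W k x)
  from rim_W.prems show ?case
  proof (cases rule: grow_ConsE)
    case 1
    then show ?thesis
      using rim_strip[OF rim.rim_W[OF rim_Nil] rim_W.hyps, of 1] by simp
  next
    case (3 v')
    with rim_W.hyps have "rim k (N # v')" by simp
    then show ?thesis
    proof (cases rule: rim.cases)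
      \<comment> \<open>The rest begins with \<open>N\<close>, so its first row has no protruding
        cell and \<open>m = c\<close>; absorbing the \<open>W\<close> lets it cover one edge
        more.\<close>
      case (rim_strip m z k' x' c)
      have "m - c = 0" using rim_strip(2) by (cases "m - c") simp_all
      with \<open>c \<le> m\<close> have "m = c" by linarith
      with rim_strip(2) have v': "v' = z @ S # x'" by simp
      have "rim (Suc c + k') (replicate (Suc m - Suc c) E @ N # (W # z) @ S # x')"
        by (rule rim.rim_strip[OF rim.rim_W]) (use rim_strip(3,4) \<open>m = c\<close> in auto)
      moreover have "F' = replicate (Suc m - Suc c) E @ N # (W # z) @ S # x'"
        unfolding 3(3) v' \<open>m = c\<close> by simp
      moreover have "Suc k = Suc c + k'"
        using rim_strip(1) by simp
      ultimately show ?thesis by metis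
    qed
  next
    case (4 v')
    then show ?thesis using rim_W.IH by (auto intro: rim.rim_W)
  qed auto
next
  case (rim_strip m z k x c)
  have noE: "\<not> grow (replicate j E) r" for j r
    by (induction j arbitrary: r) (auto simp: grow_Nil elim!: grow_ConsE)
  from rim_strip.prems show ?case
  proof (cases rule: grow_appendE)
    case (1 xs')
    then show ?thesis using noE by blast
  next
    case (2 ys')
    from 2(1) show ?thesis
    proof (cases rule: grow_ConsE)
      case 2: 2
      have "rim (c + k) (replicate (Suc m - c) E @ N # (W # z) @ S # x)"
        by (rule rim.rim_strip[OF rim.rim_W]) (use rim_strip in auto)
      moreover have "Suc m - c = Suc (m - c)" using rim_strip by auto
      ultimately show ?thesis
        using \<open>F' = _\<close> 2 by (simp add: replicate_app_Cons_same)
    next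
      case (4 v')
      from 4(1) show ?thesis
      proof (cases rule: grow_appendE)
        case (1 z')
        then show ?thesis using 4 \<open>F' = _\<close> rim_strip by (auto intro!: rim.rim_strip)
      next
        case (2 w)
        from 2(1) obtain x' where "grow x x'" "w = S # x'" by (auto elim: grow_ConsE)
        then show ?thesis using 2 4 \<open>F' = _\<close> rim_strip by (auto intro!: rim.rim_strip)
      qed auto
    qed auto
  next
    case (3 xs0 ys0)
    then have "W \<in> set (replicate (m - c) E)" by (metis in_set_conv_decomp)
    then show ?thesis by simp
  qed
qed

lemma grows_append_left: "grow\<^sup>*\<^sup>* v v' \<Longrightarrow> grow\<^sup>*\<^sup>* (u @ v) (u @ v')"
  by (induction rule: rtranclp_induct) (auto intro: rtranclp.rtrancl_into_rtrancl grow_append_left)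

lemma grows_append_right: "grow\<^sup>*\<^sup>* v v' \<Longrightarrow> grow\<^sup>*\<^sup>* (v @ w) (v' @ w)"
  by (induction rule: rtranclp_induct) (auto intro: rtranclp.rtrancl_into_rtrancl grow_append_right)

lemma grows_absorb: "grow\<^sup>*\<^sup>* (replicate j W @ N # v) (N # replicate j W @ v)"
proof (induction j arbitrary: v)
  case (Suc j)
  have "grow\<^sup>*\<^sup>* (replicate j W @ W # N # v) (replicate j W @ N # W # v)"
    by (intro grows_append_left r_into_rtranclp grow_WN)
  also have "grow\<^sup>*\<^sup>* \<dots> (N # replicate j W @ W # v)"
    by (rule Suc.IH)
  finally show ?case by (simp add: replicate_app_Cons_same)
qed simp

lemma grows_sprout: "grow\<^sup>*\<^sup>* (N # v) (replicate j E @ N # replicate j W @ v)"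
proof (induction j)
  case (Suc j)
  note Suc
  also have "grow\<^sup>*\<^sup>* (replicate j E @ N # replicate j W @ v)
      (replicate j E @ E # N # W # replicate j W @ v)"
    by (intro grows_append_left r_into_rtranclp grow_N)
  finally show ?case by (simp add: replicate_app_Cons_same)
qed simp

text \<open>A row over \<open>c\<close> edges is built cell by cell: glue to the last edge, absorb
  the \<open>c - 1\<close> edges before it, sprout the \<open>m - c\<close> protruding cells from
  the \<open>N\<close>, then grow the upper path.\<close>

lemma grows_rim: "rim k F \<Longrightarrow> grow\<^sup>*\<^sup>* (replicate k W) F"
proof (induction rule: rim.induct)
  case (rim_W k x)
  then show ?case using grows_append_left[of _ _ "[W]"] by simp
next
  case (rim_strip m z k x c)
  obtain d where c: "c = Suc d" using rim_strip by (cases c) auto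
  have "grow\<^sup>*\<^sup>* (replicate c W @ replicate k W) (replicate c W @ x)"
    by (intro grows_append_left rim_strip)
  also have "grow\<^sup>*\<^sup>* (replicate c W @ x) (replicate d W @ N # W # S # x)"
    unfolding c by (simp add: replicate_app_Cons_same[symmetric])
      (intro grows_append_left r_into_rtranclp grow_W)
  also have "grow\<^sup>*\<^sup>* \<dots> (N # replicate d W @ W # S # x)"
    by (rule grows_absorb)
  also have "\<dots> = N # replicate c W @ S # x"
    by (simp add: c replicate_app_Cons_same)
  also have "grow\<^sup>*\<^sup>* \<dots> (replicate (m - c) E @ N # replicate (m - c) W @ replicate c W @ S # x)"
    by (rule grows_sprout)
  also have "\<dots> = (replicate (m - c) E @ [N]) @ replicate m W @ S # x"
    using rim_strip by (simp flip: replicate_add append_assoc)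
  also have "grow\<^sup>*\<^sup>* \<dots> ((replicate (m - c) E @ [N]) @ z @ S # x)"
    by (intro grows_append_left grows_append_right rim_strip)
  finally show ?case by (simp add: replicate_add)
qed simp

text \<open>The initial cell is a row over a single edge, so removing the leading \<open>E\<close>
  of a fish leaves a word grown from \<open>[W]\<close>. The excluded word \<open>[W]\<close> would
  be a fish without cells.\<close>

lemma fighting_fish_iff_rim: "fighting_fish F \<longleftrightarrow> (\<exists>Y. F = E # Y \<and> rim 1 Y \<and> Y \<noteq> [W])"
proof
  assume "fighting_fish F"
  have closed: "\<exists>Y. F' = E # Y \<and> rim 1 Y \<and> Y \<noteq> [W]"
    if "\<exists>Y. F = E # Y \<and> rim 1 Y \<and> Y \<noteq> [W]" "grow F F'" for F F'
  proof -
    from that obtain Y where Y: "F = E # Y" "rim 1 Y" "Y \<noteq> [W]" by blast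
    with \<open>grow F F'\<close> obtain Y' where Y': "F' = E # Y'" "grow Y Y'" by (auto elim: grow_ConsE)
    moreover have "Y' \<noteq> [W]"
      using Y'(2) Y(3) by (auto elim: grow.cases simp: grow_Nil)
    ultimately show ?thesis using rim_grow Y by blast
  qed
  show "\<exists>Y. F = E # Y \<and> rim 1 Y \<and> Y \<noteq> [W]"
    using \<open>fighting_fish F\<close>
  proof (induction rule: fighting_fish.induct)
    case cell
    show ?case using rim_strip[OF rim_W[OF rim_Nil] rim_Nil, of 1] by simp
  next
    case (glue_W u v)
    show ?case by (rule closed[OF glue_W.IH]) (auto intro: grow_append_left grow_W)
  next
    case (glue_N u v)
    show ?case by (rule closed[OF glue_N.IH]) (auto intro: grow_append_left grow_N)
  next
    case (glue_WN u v)
    show ?case by (rule closed[OF glue_WN.IH]) (auto intro: grow_append_left grow_WN)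
  qed
next
  assume "\<exists>Y. F = E # Y \<and> rim 1 Y \<and> Y \<noteq> [W]"
  then obtain Y where Y: "F = E # Y" "rim 1 Y" "Y \<noteq> [W]" by blast
  then have "grow\<^sup>*\<^sup>* [W] Y" using grows_rim[of 1 Y] by simp
  then obtain Y0 where Y0: "grow [W] Y0" "grow\<^sup>*\<^sup>* Y0 Y"
    using Y(3) by (metis converse_rtranclpE)
  then have "Y0 = [N, W, S]" by (auto elim!: grow_ConsE simp: grow_Nil)
  from Y0(2)[unfolded this] have "fighting_fish (E # Y)"
    by (induction rule: rtranclp_induct) (auto intro: cell fighting_fish_grow grow_Cons)
  then show "fighting_fish F" by (simp add: Y)
qed

section \<open>Contracting \<open>WN\<close> to \<open>V\<close> and expanding it again\<close>

lemma contract_Cons: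
  assumes "0 \<notin> I"
  shows "contract I (a # F) = a # contract {i. Suc i \<in> I} F"
proof -
  have *: "[0..<length (a # F)] = 0 # map Suc [0..<length F]"
    by (simp add: upt_conv_Cons map_Suc_upt del: upt_Suc)
  have "(if Suc i \<in> I then [V] else if 0 < Suc i \<and> Suc i - 1 \<in> I then [] else [(a # F) ! Suc i]) =
      (if i \<in> {i. Suc i \<in> I} then [V] else if 0 < i \<and> i - 1 \<in> {i. Suc i \<in> I} then [] else [F ! i])" for i
    using assms by (cases i) auto
  then show ?thesis
    unfolding contract_def * using assms by (simp add: comp_def)
qed

lemma contract_Cons_Cons:
  assumes "0 \<in> I" "1 \<notin> I"
  shows "contract I (a # b # F) = V # contract {i. Suc (Suc i) \<in> I} F"
proof -
  have *: "[0..<length (a # b # F)] = 0 # 1 # map (\<lambda>i. Suc (Suc i)) [0..<length F]"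
    by (simp add: upt_conv_Cons map_Suc_upt[symmetric] comp_def del: upt_Suc)
  have "(if Suc (Suc i) \<in> I then [V] else if 0 < Suc (Suc i) \<and> Suc (Suc i) - 1 \<in> I then [] else [(a # b # F) ! Suc (Suc i)]) =
      (if i \<in> {i. Suc (Suc i) \<in> I} then [V] else if 0 < i \<and> i - 1 \<in> {i. Suc (Suc i) \<in> I} then [] else [F ! i])" for i
    using assms by (cases i) auto
  then show ?thesis
    unfolding contract_def * using assms by (simp add: comp_def)
qed

text \<open>The witness consists of the positions where the factors \<open>WN\<close> stemming from
  a \<open>V\<close> of \<open>G\<close> start. Hence \<open>expand G\<close> alone decides whether
  \<open>G\<close> is an extended fish.\<close>

lemma contract_expand: "\<exists>I \<subseteq> WN_occs (expand G). contract I (expand G) = G"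
proof (induction G)
  case Nil
  show ?case by (auto simp: contract_def)
next
  case (Cons a G)
  then obtain I where I: "I \<subseteq> WN_occs (expand G)" "contract I (expand G) = G" by blast
  show ?case
  proof (cases "a = V")
    case True
    let ?I = "insert 0 ((\<lambda>i. Suc (Suc i)) ` I)"
    have "?I \<subseteq> WN_occs (expand (a # G))"
      using I(1) True by (auto simp: WN_occs_def)
    moreover have "{i. Suc (Suc i) \<in> ?I} = I" by auto
    then have "contract ?I (expand (a # G)) = a # G"
      using I(2) True by (simp add: contract_Cons_Cons image_iff)
    ultimately show ?thesis by blast
  next
    case False
    have "Suc ` I \<subseteq> WN_occs (expand (a # G))"
      using I(1) False by (auto simp: WN_occs_def)
    moreover have "contract (Suc ` I) (expand (a # G)) = a # G"
      using I(2) False by (simp add: contract_Cons image_iff)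
    ultimately show ?thesis by blast
  qed
qed

lemma extended_fighting_fish_iff: "extended_fighting_fish G \<longleftrightarrow> fighting_fish (expand G)"
  using contract_expand[of G] extended_fighting_fish_expand[of G]
  unfolding extended_fighting_fish_def by metis

section \<open>Labelled binary trees\<close>

text \<open>
  A letter \<^const>\<open>W\<close> of the rim, a strip of cells, and a strip whose leading factor \<open>WN\<close> was contracted
  to \<^const>\<open>V\<close> are encoded by one constructor: \<open>Node c z x\<close> is a strip below \<open>z\<close> that covers \<open>c\<close>
  edges, where the two degenerate cases are \<open>z = Tip\<close> and \<open>c = width z + 1\<close>. With this convention
  the size of a fish is the number of nodes of its tree.
\<close>

datatype tree = Tip | Node nat tree tree

primrec width :: "tree \<Rightarrow> nat" where
  "width Tip = 0"
| "width (Node c z x) = c + width x"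

primrec nodes :: "tree \<Rightarrow> nat" where
  "nodes Tip = 0"
| "nodes (Node c z x) = Suc (nodes z + nodes x)"

primrec cells :: "tree \<Rightarrow> nat" where
  "cells Tip = 0"
| "cells (Node c z x) = width z + cells z + cells x"

primrec valid :: "tree \<Rightarrow> bool" where
  "valid Tip = True"
| "valid (Node c z x) = (valid z \<and> valid x \<and> 1 \<le> c \<and> c \<le> Suc (width z))"

primrec word :: "tree \<Rightarrow> letter list" where
  "word Tip = []"
| "word (Node c z x) =
    (if z = Tip then [W]
     else if c = Suc (width z) then V # word z @ [S]
     else replicate (width z - c) E @ N # word z @ [S]) @ word x"

lemma width_pos: "valid t \<Longrightarrow> t \<noteq> Tip \<Longrightarrow> 1 \<le> width t"
  by (cases t) auto

lemma rim_expand_word: "valid t \<Longrightarrow> rim (width t) (expand (word t))"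
proof (induction t)
  case Tip
  show ?case by (simp add: rim_Nil)
next
  case (Node c z x)
  have E: "expand (replicate j E @ v) = replicate j E @ expand v" for j v
    by (induction j) auto
  consider "z = Tip" | "z \<noteq> Tip" "c = Suc (width z)" | "z \<noteq> Tip" "c \<le> width z"
    using Node.prems by fastforce
  then show ?case
  proof cases
    case 1
    with Node.prems have "c = 1" by auto
    with 1 Node show ?thesis by (auto intro: rim_W)
  next
    case 2
    then have "1 \<le> width z" using Node.prems width_pos by auto
    with 2 Node have "rim (width z + width x)
        (replicate (width z - width z) E @ N # expand (word z) @ S # expand (word x))"
      by (intro rim_strip) auto
    then show ?thesis using 2 rim_W by simp
  next
    case 3
    with Node have "rim (c + width x)
        (replicate (width z - c) E @ N # expand (word z) @ S # expand (word x))"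
      by (intro rim_strip) auto
    then show ?thesis using 3 E by simp
  qed
qed

text \<open>A \<open>V\<close> expands to two letters, so a cut of \<open>expand G\<close> need not
  come from a cut of \<open>G\<close>. The condition on \<open>a\<close> rules out a cut between
  \<open>W\<close> and \<open>N\<close>.\<close>

lemma expand_eq_append:
  assumes "expand G = F1 @ a # F2" "a \<noteq> N"
  obtains G1 G2 where "G = G1 @ G2" "expand G1 = F1" "expand G2 = a # F2"
  using assms
proof (induction G arbitrary: F1 thesis)
  case Nil
  then show ?case by simp
next
  case (Cons b G)
  show ?case
  proof (cases "F1 = []")
    case True
    then show ?thesis using Cons.prems(1)[of "[]" "b # G"] Cons.prems(2) by simp
  next
    case False
    show ?thesis
    proof (cases "b = V")
      case True
      with Cons.prems False have "\<exists>F1'. F1 = W # N # F1'"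
        by (auto simp: Cons_eq_append_conv)
      then obtain F1' where F1': "F1 = W # N # F1'" by blast
      obtain G1 G2 where "G = G1 @ G2" "expand G1 = F1'" "expand G2 = a # F2"
        by (rule Cons.IH[of F1']) (use Cons.prems F1' True in auto)
      then show ?thesis using Cons.prems(1)[of "b # G1" G2] F1' True by simp
    next
      case bV: False
      with Cons.prems False obtain F1' where F1': "F1 = b # F1'"
        by (auto simp: Cons_eq_append_conv)
      obtain G1 G2 where "G = G1 @ G2" "expand G1 = F1'" "expand G2 = a # F2"
        by (rule Cons.IH[of F1']) (use Cons.prems F1' bV in auto)
      then show ?thesis using Cons.prems(1)[of "b # G1" G2] F1' bV by simp
    qed
  qed
qed

lemma expand_eq_ConsE:
  assumes "expand G = a # F" "a \<noteq> W"
  obtains G' where "G = a # G'" "expand G' = F"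
  using assms by (cases G) (auto split: if_splits)

lemma rim_expandD: "rim k F \<Longrightarrow> expand G = F \<Longrightarrow> \<exists>t. valid t \<and> width t = k \<and> word t = G"
proof (induction arbitrary: G rule: rim.induct)
  case rim_Nil
  then have "G = []" by (cases G) (auto split: if_splits)
  then show ?case by (intro exI[of _ Tip]) simp
next
  case (rim_W k x)
  then consider G' where "G = W # G'" "expand G' = x" | G' where "G = V # G'" "N # expand G' = x"
    by (cases G) (auto split: if_splits)
  then show ?case
  proof cases
    case 1
    from rim_W.IH[OF 1(2)] obtain t where "valid t" "width t = k" "word t = G'" by blast
    then show ?thesis using 1 by (intro exI[of _ "Node 1 Tip t"]) simp
  next
    case 2
    \<comment> \<open>Replace the leading \<open>V\<close> by \<open>N\<close>: the tree of that
      word starts with a row of label \<open>width z\<close>, and raising this label by one restores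
      the \<open>V\<close>.\<close>
    then have "expand (N # G') = x" by simp
    from rim_W.IH[OF this] obtain t where t: "valid t" "width t = k" "word t = N # G'" by blast
    then obtain c z y where cz: "t = Node c z y" by (cases t) auto
    with t have zc: "z \<noteq> Tip" "c \<noteq> Suc (width z)" by (auto split: if_splits)
    with t cz have "width z - c = 0" by (cases "width z - c") auto
    with t cz zc have "c = width z" by auto
    with t cz zc show ?thesis
      by (intro exI[of _ "Node (Suc c) z y"]) (use 2 in auto)
  qed
next
  case (rim_strip m z k x c)
  have split: "\<exists>G'. G = replicate j E @ G' \<and> expand G' = F"
    if "expand G = replicate j E @ F" for j G F
    using that
  proof (induction j arbitrary: G)
    case (Suc j)
    then obtain G' where "G = E # G'" "expand G' = replicate j E @ F"
      by (auto elim: expand_eq_ConsE)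
    then show ?case using Suc.IH by auto
  qed simp
  from split[OF rim_strip.prems] obtain G' where
    G': "G = replicate (m - c) E @ G'" "expand G' = N # z @ S # x" by blast
  from G'(2) obtain G2 where G2: "G' = N # G2" "expand G2 = z @ S # x"
    by (auto elim: expand_eq_ConsE)
  from G2(2) obtain G3 G4 where G3: "G2 = G3 @ G4" "expand G3 = z" "expand G4 = S # x"
    by (auto elim: expand_eq_append)
  from G3(3) obtain G5 where G5: "G4 = S # G5" "expand G5 = x"
    by (auto elim: expand_eq_ConsE)
  from rim_strip.IH(1)[OF G3(2)] obtain t where t: "valid t" "width t = m" "word t = G3" by blast
  from rim_strip.IH(2)[OF G5(2)] obtain u where u: "valid u" "width u = k" "word u = G5" by blast
  have "t \<noteq> Tip" using t rim_strip by auto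
  then show ?case
    using t u rim_strip G' G2 G3 G5 by (intro exI[of _ "Node c t u"]) auto
qed

lemma word_neq_S: "word t \<noteq> S # v"
proof (cases t)
  case (Node c z x)
  then show ?thesis by (cases "width z - c") auto
qed simp

lemma replicate_E_N_eq:
  "replicate i E @ N # v = replicate j E @ N # w \<Longrightarrow> i = j \<and> v = w"
proof (induction i arbitrary: j)
  case 0
  then show ?case by (cases j) auto
next
  case (Suc i)
  then show ?case by (cases j) auto
qed

text \<open>Unique parsing: no word of a tree begins with \<open>S\<close>, so an \<open>S\<close>
  after such a word marks its end. The arbitrary suffixes make the induction work, since
  \<open>word z\<close> is followed by the rest of the whole word.\<close>

lemma word_append_S_eq:
  "valid t \<Longrightarrow> valid u \<Longrightarrow> word t @ S # v = word u @ S # w \<Longrightarrow> t = u \<and> v = w"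
proof (induction t arbitrary: u v w)
  case Tip
  then have S: "S # v = word u @ S # w" by simp
  have "word u = []"
    using S word_neq_S[of u] by (cases "word u") auto
  then have "u = Tip" by (cases u) (auto split: if_splits)
  with S show ?case by simp
next
  case (Node c z x)
  have "u \<noteq> Tip"
  proof
    assume "u = Tip"
    with Node.prems(3) have "word (Node c z x) @ S # v = S # w" by simp
    moreover have "word (Node c z x) \<noteq> []" by simp
    ultimately show False using word_neq_S[of "Node c z x"]
      by (cases "word (Node c z x)") (auto simp del: word.simps)
  qed
  then obtain c' z' x' where u: "u = Node c' z' x'" by (cases u) auto
  let ?b = "\<lambda>c z. if z = Tip then 0 else if c = Suc (width z) then (1::nat) else 2"
  consider (W) "z = Tip" | (V) "z \<noteq> Tip" "c = Suc (width z)" | (E) "z \<noteq> Tip" "c \<le> width z" "c \<noteq> Suc (width z)"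
    using Node.prems by fastforce
  then show ?case
  proof cases
    case W
    have c: "c = 1" using W Node.prems by auto
    from W Node.prems(3) u have z': "z' = Tip"
      by (cases "width z' - c'") (auto split: if_splits)
    then have c': "c' = 1" using u Node.prems by auto
    have "word x @ S # v = word x' @ S # w" using Node.prems(3) W u z' by simp
    from Node.IH(2)[OF _ _ this] show ?thesis using Node.prems W u z' c c' by auto
  next
    case V
    from V Node.prems(3) u have z': "z' \<noteq> Tip" "c' = Suc (width z')"
      by (cases "width z' - c'"; auto split: if_splits)+
    have "word z @ S # (word x @ S # v) = word z' @ S # (word x' @ S # w)"
      using Node.prems(3) V u z' by simp
    from Node.IH(1)[OF _ _ this] have z: "z = z'" "word x @ S # v = word x' @ S # w"
      using Node.prems u by auto
    from Node.IH(2)[OF _ _ z(2)] show ?thesis using Node.prems u z z' V by auto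
  next
    case E
    from E Node.prems(3) u have z': "z' \<noteq> Tip" "c' \<noteq> Suc (width z')"
      by (cases "width z - c"; auto split: if_splits)+
    then have c': "c' \<le> width z'" using u Node.prems(2) by auto
    have "replicate (width z - c) E @ N # (word z @ S # (word x @ S # v))
        = replicate (width z' - c') E @ N # (word z' @ S # (word x' @ S # w))"
      using Node.prems(3) E u z' by simp
    from replicate_E_N_eq[OF this] have eq: "width z - c = width z' - c'"
      "word z @ S # (word x @ S # v) = word z' @ S # (word x' @ S # w)" by auto
    from Node.IH(1)[OF _ _ eq(2)] have z: "z = z'" "word x @ S # v = word x' @ S # w"
      using Node.prems u by auto
    from Node.IH(2)[OF _ _ z(2)] have x: "x = x'" "v = w" using Node.prems u by auto
    have "c = c'" using eq(1) z(1) E(2) c' by auto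
    then show ?thesis using x z u by simp
  qed
qed

lemma inj_on_word: "inj_on word {t. valid t}"
  by (rule inj_onI) (use word_append_S_eq[where v = "[]" and w = "[]"] in auto)

section \<open>The size-preserving bijection between trees and fish\<close>

definition trees :: "nat \<Rightarrow> tree set" where
  "trees n = {t. valid t \<and> nodes t = n}"

text \<open>The root \<open>Node 1 t Tip\<close> is the bottom row: it covers the single edge from
  which the fish grows, and has \<open>width t\<close> cells.\<close>

definition fish_of_tree :: "tree \<Rightarrow> letter list" where
  "fish_of_tree t = E # word (Node 1 t Tip)"

lemma valid_width_1D:
  assumes "valid t" "width t = 1"
  obtains z where "t = Node 1 z Tip" "valid z"
proof (cases t)
  case (Node c z x)
  with assms have "c = 1" "width x = 0" by auto
  with Node assms width_pos[of x] have "x = Tip" by auto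
  with that Node assms \<open>c = 1\<close> show ?thesis by auto
qed (use assms in auto)

lemma extended_fighting_fish_iff_tree:
  "extended_fighting_fish G \<longleftrightarrow> (\<exists>t. valid t \<and> t \<noteq> Tip \<and> G = fish_of_tree t)"
proof
  assume "extended_fighting_fish G"
  then obtain Y where Y: "expand G = E # Y" "rim 1 Y" "Y \<noteq> [W]"
    unfolding extended_fighting_fish_iff fighting_fish_iff_rim by blast
  from Y(1) obtain G' where G': "G = E # G'" "expand G' = Y" by (auto elim: expand_eq_ConsE)
  from rim_expandD[OF Y(2) G'(2)] obtain t where t: "valid t" "width t = 1" "word t = G'" by blast
  from t(1,2) obtain z where z: "t = Node 1 z Tip" "valid z" by (rule valid_width_1D)
  have "z \<noteq> Tip" using Y(3) G' t z by auto
  then show "\<exists>t. valid t \<and> t \<noteq> Tip \<and> G = fish_of_tree t"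
    using z t G' unfolding fish_of_tree_def by blast
next
  assume "\<exists>t. valid t \<and> t \<noteq> Tip \<and> G = fish_of_tree t"
  then obtain t where t: "valid t" "t \<noteq> Tip" "G = fish_of_tree t" by blast
  let ?Y = "expand (word (Node 1 t Tip))"
  have "rim 1 ?Y"
    using rim_expand_word[of "Node 1 t Tip"] t width_pos[of t] by simp
  moreover have "length ?Y > 1"
    using t by simp
  then have "?Y \<noteq> [W]" by auto
  ultimately show "extended_fighting_fish G"
    unfolding extended_fighting_fish_iff fighting_fish_iff_rim t(3) fish_of_tree_def by auto
qed

lemma count_list_replicate: "count_list (replicate k x) y = (if x = y then k else 0)"
  by (induction k) auto

text \<open>Raising the label of a row by one widens the path by one and removes one counted letter:
  an \<open>E\<close>, or the \<open>N\<close> in the last step, where \<open>V\<close> appears.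
  This is why size becomes the number of nodes.\<close>

lemma word_counts:
  "valid t \<Longrightarrow> count_list (word t) E + count_list (word t) N + width t = nodes t \<and>
    lat (word t) = 0 \<and> long (word t) = - int (width t)"
proof (induction t)
  case (Node c z x)
  then have IH: "count_list (word z) E + count_list (word z) N + width z = nodes z"
    "lat (word z) = 0" "long (word z) = - int (width z)"
    "count_list (word x) E + count_list (word x) N + width x = nodes x"
    "lat (word x) = 0" "long (word x) = - int (width x)" by auto
  consider (W) "z = Tip" | (V) "z \<noteq> Tip" "c = Suc (width z)" | (E) "z \<noteq> Tip" "c \<le> width z" "c \<noteq> Suc (width z)"
    using Node.prems by fastforce
  then show ?case
    by cases (use IH Node.prems in \<open>auto simp: lat_def long_def count_list_replicate\<close>)
qed (auto simp: lat_def long_def)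

lemma fish_size_fish_of_tree: "valid t \<Longrightarrow> t \<noteq> Tip \<Longrightarrow> fish_size (fish_of_tree t) = nodes t"
  using word_counts[of "Node 1 t Tip"] width_pos[of t]
  by (simp add: fish_of_tree_def fish_size_def del: word.simps)

lemma EF_eq_trees:
  assumes "n \<ge> 1"
  shows "EF n = fish_of_tree ` trees n"
proof -
  have "t \<noteq> Tip" if "nodes t = n" for t
    using that assms by auto
  then show ?thesis
    unfolding EF_def trees_def extended_fighting_fish_iff_tree
    by (fastforce simp: fish_size_fish_of_tree)
qed

lemma inj_on_fish_of_tree: "inj_on fish_of_tree (trees n)"
proof (rule inj_onI)
  fix t u assume tu: "t \<in> trees n" "u \<in> trees n" "fish_of_tree t = fish_of_tree u"
  then have "Node 1 t Tip = Node 1 u Tip"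
    by (intro inj_onD[OF inj_on_word]) (auto simp: trees_def fish_of_tree_def simp del: word.simps)
  then show "t = u" by simp
qed

section \<open>Area of a word, row by row\<close>

lemma lat_Nil: "lat [] = 0" and lat_Cons: "lat (a # F) = lat [a] + lat F"
  and long_Nil: "long [] = 0" and long_Cons: "long (a # F) = long [a] + long F"
  by (auto simp: lat_def long_def)

lemma lat_append: "lat (F @ G) = lat F + lat G"
  and long_append: "long (F @ G) = long F + long G"
  by (auto simp: lat_def long_def)

lemma area_Cons: "area (a # F) = lat [a] * long [a] + area F + long [a] * lat F"
proof -
  have "area (a # F) = (\<Sum>k\<in>insert 1 {2..Suc (length F)}.
      (lat (take k (a # F)) - lat (take (k - 1) (a # F))) * long (take k (a # F)))"
    unfolding area_def by (rule sum.cong) auto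
  also have "\<dots> = lat [a] * long [a] + (\<Sum>k=2..Suc (length F).
      (lat (take k (a # F)) - lat (take (k - 1) (a # F))) * long (take k (a # F)))"
    by (simp add: lat_Nil)
  also have "(\<Sum>k=2..Suc (length F).
      (lat (take k (a # F)) - lat (take (k - 1) (a # F))) * long (take k (a # F))) =
    (\<Sum>k=1..length F. (lat (take k F) - lat (take (k - 1) F)) * (long [a] + long (take k F)))"
    by (rule sum.reindex_bij_witness[of _ Suc "\<lambda>k. k - 1"])
      (auto simp: lat_Cons[of a "take _ _"] long_Cons[of a "take _ _"] take_Cons' lat_Nil)
  also have "\<dots> = area F + long [a] * (\<Sum>k=1..length F. lat (take k F) - lat (take (k - 1) F))"
    unfolding area_def by (simp add: algebra_simps sum.distrib sum_distrib_left sum_subtractf)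
  also have "(\<Sum>k=1..length F. lat (take k F) - lat (take (k - 1) F)) = lat F"
    using sum_telescope''[of 0 "length F" "\<lambda>k. lat (take k F)"] by (simp add: lat_Nil)
  finally show ?thesis by simp
qed

text \<open>The prefix shifts \<open>G\<close> sideways by \<open>long F\<close>, so each vertical
  step of \<open>G\<close> counts that much more; summed up, only the net height
  \<open>lat G\<close> remains.\<close>

lemma area_append: "area (F @ G) = area F + area G + long F * lat G"
proof (induction F)
  case Nil
  show ?case by (simp add: area_def long_Nil)
next
  case (Cons a F)
  then show ?case
    by (simp add: area_Cons lat_append long_Cons[of a F] algebra_simps)
qed

lemma area_replicate_E: "area (replicate k E) = 0"
proof (induction k)
  case 0
  show ?case by (simp add: area_def)
next
  case (Suc k)
  have "lat (replicate k E) = 0" by (simp add: lat_def count_list_replicate)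
  with Suc show ?case by (simp add: area_Cons lat_def)
qed

text \<open>The two outer vertical letters of a row contribute \<open>width z - c\<close> and
  \<open>c\<close>, or -1 and \<open>width z + 1\<close> if the first of them is \<open>V\<close>.
  Either way the sum is \<open>width z\<close>, the number of cells of the row.\<close>

lemma area_word: "valid t \<Longrightarrow> area (word t) = int (cells t)"
proof (induction t)
  case Tip
  show ?case by (simp add: area_def)
next
  case (Node c z x)
  then have IH: "area (word z) = int (cells z)" "area (word x) = int (cells x)"
    "lat (word z) = 0" "long (word z) = - int (width z)" "lat (word x) = 0"
    using word_counts by auto
  have [simp]: "area [] = 0" by (simp add: area_def)
  have letters: "lat [E] = 0" "lat [N] = 1" "lat [W] = 0" "lat [S] = -1" "lat [V] = 1"
    "long [E] = 1" "long [N] = 0" "long [W] = -1" "long [S] = 0" "long [V] = -1"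
    "lat (replicate k E) = 0" "long (replicate k E) = int k" for k
    by (auto simp: lat_def long_def count_list_replicate)
  consider (W) "z = Tip" | (V) "z \<noteq> Tip" "c = Suc (width z)" | (E) "z \<noteq> Tip" "c \<le> width z" "c \<noteq> Suc (width z)"
    using Node.prems by fastforce
  then show ?case
    by cases (use IH in \<open>auto simp: area_append area_Cons[of _ "_ @ _"] area_Cons[of _ "[]"]
      lat_append lat_Cons[of _ "_ @ _"] lat_Nil long_Cons[of _ "_ @ _"] long_append letters area_replicate_E
      area_Cons[of _ "word _"] lat_Cons[of _ "word _"] algebra_simps\<close>)
qed

lemma area_fish_of_tree: "valid t \<Longrightarrow> area (fish_of_tree t) = int (width t + cells t)"
  using area_word[of "Node 1 t Tip"] word_counts[of "Node 1 t Tip"] width_pos[of t]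
  by (cases "t = Tip") (simp_all add: fish_of_tree_def area_Cons lat_def long_def del: word.simps)

lemma card_EF: "n \<ge> 1 \<Longrightarrow> card (EF n) = card (trees n)"
  by (simp add: EF_eq_trees card_image inj_on_fish_of_tree)

lemma sum_area_EF: "n \<ge> 1 \<Longrightarrow> (\<Sum>F\<in>EF n. real_of_int (area F)) = (\<Sum>t\<in>trees n. real (width t + cells t))"
  unfolding EF_eq_trees sum.reindex[OF inj_on_fish_of_tree]
  by (rule sum.cong) (auto simp: area_fish_of_tree trees_def)

section \<open>Recursive enumeration of trees by size\<close>

lemma trees_0: "trees 0 = {Tip}"
proof -
  have "t = Tip" if "nodes t = 0" for t
    using that by (cases t) auto
  then show ?thesis by (auto simp: trees_def)
qed

lemma trees_Suc:
  "trees (Suc n) = (\<lambda>(i, z, x, c). Node c z x) `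
    (SIGMA i:{..n}. SIGMA z:trees i. SIGMA x:trees (n - i). {1..Suc (width z)})"
proof (intro set_eqI iffI)
  fix t assume "t \<in> trees (Suc n)"
  then obtain c z x where "t = Node c z x" by (cases t) (auto simp: trees_def)
  with \<open>t \<in> trees (Suc n)\<close> show "t \<in> (\<lambda>(i, z, x, c). Node c z x) `
    (SIGMA i:{..n}. SIGMA z:trees i. SIGMA x:trees (n - i). {1..Suc (width z)})"
    by (intro image_eqI[of _ _ "(nodes z, z, x, c)"]) (auto simp: trees_def)
qed (auto simp: trees_def)

lemma finite_trees: "finite (trees n)"
proof (induction n rule: less_induct)
  case (less n)
  show ?case
  proof (cases n)
    case 0
    then show ?thesis by (simp add: trees_0)
  next
    case (Suc m)
    have "finite (trees i)" "finite (trees (m - i))" if "i \<le> m" for i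
      using less that Suc by auto
    then show ?thesis
      unfolding Suc trees_Suc by (intro finite_imageI finite_SigmaI) auto
  qed
qed

lemma sum_trees_Suc:
  fixes f :: "tree \<Rightarrow> 'a :: comm_monoid_add"
  shows "(\<Sum>t\<in>trees (Suc n). f t) =
    (\<Sum>i\<le>n. \<Sum>z\<in>trees i. \<Sum>x\<in>trees (n - i). \<Sum>c=1..Suc (width z). f (Node c z x))"
proof -
  have "inj_on (\<lambda>(i, z, x, c). Node c z x)
    (SIGMA i:{..n}. SIGMA z:trees i. SIGMA x:trees (n - i). {1..Suc (width z)})"
    by (auto simp: inj_on_def trees_def)
  then show ?thesis
    unfolding trees_Suc
    by (simp add: sum.reindex sum.Sigma finite_trees split_def comp_def del: sum.cl_ivl_Suc)
qed

section \<open>Formal power series\<close>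

text \<open>The contraction principle for power series: coefficient \<open>n\<close> of the iterates
  \<open>s k\<close> is constant once \<open>k > n\<close>. It supplies the kernel root, which is
  given only implicitly through \<open>width_gf\<close>.\<close>

lemma fps_fixed_point:
  fixes \<Phi> :: "'a :: zero fps \<Rightarrow> 'a fps"
  assumes "\<And>a b n. (\<And>i. i < n \<Longrightarrow> fps_nth a i = fps_nth b i) \<Longrightarrow> fps_nth (\<Phi> a) n = fps_nth (\<Phi> b) n"
  obtains a where "\<Phi> a = a"
proof -
  define s where "s k = (\<Phi> ^^ k) 0" for k
  have stable: "fps_nth (s k) n = fps_nth (s (Suc n)) n" if "n < k" for k n
    using that
  proof (induction n arbitrary: k rule: less_induct)
    case (less n)
    then obtain k' where k': "k = Suc k'" by (cases k) auto
    have "fps_nth (s k') i = fps_nth (s n) i" if "i < n" for i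
      using less.IH[OF that, of k'] less.IH[OF that, of n] less.prems that k' by simp
    then have "fps_nth (\<Phi> (s k')) n = fps_nth (\<Phi> (s n)) n" by (rule assms)
    then show ?case by (simp add: s_def k')
  qed
  define a where "a = Abs_fps (\<lambda>n. fps_nth (s (Suc n)) n)"
  have "fps_nth (\<Phi> a) n = fps_nth a n" for n
  proof -
    have "fps_nth (\<Phi> a) n = fps_nth (\<Phi> (s n)) n"
      unfolding a_def by (rule assms) (simp add: stable[symmetric])
    then show ?thesis by (simp add: a_def s_def)
  qed
  then show ?thesis by (intro that fps_ext)
qed

lemma fps_mult_cong:
  assumes "\<And>i. i \<le> n \<Longrightarrow> fps_nth a i = fps_nth b i" "\<And>i. i \<le> n \<Longrightarrow> fps_nth c i = fps_nth d i" "k \<le> n"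
  shows "fps_nth (a * c) k = fps_nth (b * d) k"
  using assms by (auto simp: fps_mult_nth intro!: sum.cong)

lemma fps_power_cong:
  assumes "\<And>i. i \<le> n \<Longrightarrow> fps_nth a i = fps_nth b i" "k \<le> n"
  shows "fps_nth (a ^ j) k = fps_nth (b ^ j) k"
  using assms(2)
proof (induction j arbitrary: k)
  case (Suc j)
  then show ?case unfolding power_Suc by (intro fps_mult_cong[of n]) (use assms in auto)
qed simp

lemma fps_compose_cong:
  assumes "\<And>i. i \<le> n \<Longrightarrow> fps_nth a i = fps_nth b i" "k \<le> n"
  shows "fps_nth (f oo a) k = fps_nth (f oo b) k"
  unfolding fps_compose_nth by (intro sum.cong refl arg_cong2[of _ _ _ _ "(*)"] fps_power_cong[of n] assms)
    (use assms in auto)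

text \<open>Fuss-Catalan numbers, from \<open>Y ^ Suc r = Y ^ r + fps_X * Y ^ (r + p)\<close> by
  induction on \<open>k\<close> and, inside, on \<open>r\<close>. For \<open>r = k = 0\<close> the
  formula would read 0/0, which evaluates to 0 instead of 1.\<close>

lemma raney:
  fixes Y :: "real fps"
  assumes Y: "Y = 1 + fps_X * Y ^ p" and p: "1 \<le> p"
  shows "r \<ge> 1 \<or> k \<ge> 1 \<Longrightarrow> fps_nth (Y ^ r) k = real r / real (p * k + r) * real ((p * k + r) choose k)"
proof (induction k arbitrary: r)
  case 0
  have "fps_nth Y 0 = 1" by (subst Y) simp
  then show ?case using 0 by (simp add: fps_power_zeroth)
next
  case (Suc k)
  show ?case
  proof (induction r)
    case 0
    show ?case by simp
  next
    case (Suc r)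
    define M where "M = p * Suc k + r"
    have M: "M \<ge> 1" "k \<le> M" using p unfolding M_def by (auto simp: Suc_le_eq gr0_conv_Suc)
    have "Y ^ Suc r = Y ^ r * (1 + fps_X * Y ^ p)"
      using Y by simp
    also have "\<dots> = Y ^ r + fps_X * Y ^ (r + p)"
      by (simp add: algebra_simps power_add)
    finally have "fps_nth (Y ^ Suc r) (Suc k) = fps_nth (Y ^ r) (Suc k) + fps_nth (Y ^ (r + p)) k"
      by (simp del: power_Suc)
    also have "\<dots> = real r / real M * real (M choose Suc k) + real (r + p) / real M * real (M choose k)"
      using Suc.IH Suc.prems \<open>\<And>r. 1 \<le> r \<or> 1 \<le> k \<Longrightarrow> _\<close>[of "r + p"] p by (simp add: M_def algebra_simps)
    also have "real (M choose Suc k) = (real M - real k) / (real k + 1) * real (M choose k)"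
    proof -
      have "Suc k * (M choose Suc k) = (M - k) * (M choose k)"
        by (simp only: binomial_absorb_comp binomial_absorption)
      then have "real (Suc k) * real (M choose Suc k) = real (M - k) * real (M choose k)"
        by (metis of_nat_mult)
      then show ?thesis using M by (simp add: field_simps of_nat_diff)
    qed
    also have "real r / real M * ((real M - real k) / (real k + 1) * real (M choose k)) +
        real (r + p) / real M * real (M choose k) =
        (real r * (real M - real k) + (real r + real p) * (real k + 1)) / (real M * (real k + 1)) * real (M choose k)"
    proof -
      have "real M \<noteq> 0" "real k + 1 \<noteq> 0" using M by auto
      then show ?thesis by (simp add: divide_simps) (simp add: algebra_simps)
    qed
    also have "real r * (real M - real k) + (real r + real p) * (real k + 1) = (real r + 1) * real M"
      by (simp add: M_def algebra_simps)
    also have "(real r + 1) * real M / (real M * (real k + 1)) * real (M choose k) =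
        (real r + 1) / (real M + 1) * ((real M + 1) / (real k + 1) * real (M choose k))"
    proof -
      have "real M \<noteq> 0" "real M + 1 \<noteq> 0" "real k + 1 \<noteq> 0" using M by auto
      then show ?thesis by simp
    qed
    also have "(real M + 1) / (real k + 1) * real (M choose k) = real (Suc M choose Suc k)"
    proof -
      have "real (Suc k) * real (Suc M choose Suc k) = real (Suc M) * real (M choose k)"
        using Suc_times_binomial_eq[of M k] by (metis of_nat_mult mult.commute)
      then show ?thesis by (simp add: field_simps)
    qed
    finally show ?case by (simp add: M_def algebra_simps)
  qed
qed

text \<open>
  A series in \<open>t\<close> whose coefficients are series in the second variable \<open>s\<close> is evaluated at \<open>s = y(t)\<close>.
\<close>

definition fps_eval :: "real fps \<Rightarrow> real fps fps \<Rightarrow> real fps" where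
  "fps_eval y F = Abs_fps (\<lambda>n. \<Sum>i\<le>n. fps_nth (fps_nth F i oo y) (n - i))"

definition fps_embed :: "real fps \<Rightarrow> real fps fps" where
  "fps_embed H = Abs_fps (\<lambda>n. fps_const (fps_nth H n))"

lemma fps_eval_add: "fps_eval y (F + K) = fps_eval y F + fps_eval y K"
  by (intro fps_ext) (simp add: fps_eval_def fps_compose_add_distrib sum.distrib)

lemma fps_eval_diff: "fps_eval y (F - K) = fps_eval y F - fps_eval y K"
  by (intro fps_ext) (simp add: fps_eval_def fps_compose_sub_distrib sum_subtractf)

text \<open>Reindexing that makes \<open>fps_eval\<close> multiplicative: triples are regrouped by
  \<open>p = a + c\<close>, the total degree taken from the first factor.\<close>

lemma diagonal_mult:
  fixes P Q :: "nat \<Rightarrow> nat \<Rightarrow> real"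
  shows "(\<Sum>i\<le>n. \<Sum>a=0..i. \<Sum>c=0..n - i. P a c * Q (i - a) (n - i - c)) =
    (\<Sum>p=0..n. (\<Sum>a\<le>p. P a (p - a)) * (\<Sum>b\<le>n - p. Q b (n - p - b)))"
proof -
  have "(\<Sum>i\<le>n. \<Sum>a=0..i. \<Sum>c=0..n - i. P a c * Q (i - a) (n - i - c)) =
    (\<Sum>(i, a, c)\<in>(SIGMA i:{..n}. SIGMA a:{0..i}. {0..n - i}). P a c * Q (i - a) (n - i - c))"
    by (simp add: sum.Sigma)
  also have "\<dots> = (\<Sum>(p, a, b)\<in>(SIGMA p:{0..n}. SIGMA a:{..p}. {..n - p}). P a (p - a) * Q b (n - p - b))"
    by (rule sum.reindex_bij_witness[of _ "\<lambda>(p, a, b). (a + b, a, p - a)" "\<lambda>(i, a, c). (a + c, a, i - a)"])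
      (auto intro!: arg_cong2[of _ _ _ _ "(*)"] arg_cong2[of _ _ _ _ Q])
  also have "\<dots> = (\<Sum>p=0..n. (\<Sum>a\<le>p. P a (p - a)) * (\<Sum>b\<le>n - p. Q b (n - p - b)))"
    by (simp add: sum.Sigma sum_product)
  finally show ?thesis .
qed

lemma fps_eval_mult:
  assumes "fps_nth y 0 = 0"
  shows "fps_eval y (F * K) = fps_eval y F * fps_eval y K"
proof (rule fps_ext)
  fix n
  have "fps_nth (fps_eval y (F * K)) n =
    (\<Sum>i\<le>n. \<Sum>a=0..i. \<Sum>c=0..n - i. fps_nth (fps_nth F a oo y) c * fps_nth (fps_nth K (i - a) oo y) (n - i - c))"
    by (simp add: fps_eval_def fps_mult_nth[of F] fps_compose_sum_distrib fps_compose_mult_distrib[OF assms]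
        fps_sum_nth fps_mult_nth)
  also have "\<dots> = fps_nth (fps_eval y F * fps_eval y K) n"
    by (subst diagonal_mult) (simp add: fps_mult_nth fps_eval_def)
  finally show "fps_nth (fps_eval y (F * K)) n = fps_nth (fps_eval y F * fps_eval y K) n" .
qed

lemma fps_eval_const: "fps_eval y (fps_const f) = f oo y"
proof (rule fps_ext)
  fix n
  have "fps_nth (fps_eval y (fps_const f)) n = (\<Sum>i\<le>n. if i = 0 then fps_nth (f oo y) n else 0)"
    unfolding fps_eval_def fps_nth_Abs_fps by (rule sum.cong) auto
  then show "fps_nth (fps_eval y (fps_const f)) n = fps_nth (f oo y) n" by simp
qed

lemma fps_eval_1: "fps_eval y 1 = 1"
  using fps_eval_const[of y 1] by simp

lemma fps_eval_0: "fps_eval y 0 = 0"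
  using fps_eval_const[of y 0] by simp

lemma fps_eval_X: "fps_eval y fps_X = fps_X"
proof (rule fps_ext)
  fix n
  have "fps_nth (fps_eval y fps_X) n = (\<Sum>i\<le>n. if i = 1 then (if n = 1 then 1 else 0) else 0)"
    unfolding fps_eval_def fps_nth_Abs_fps by (rule sum.cong) (auto simp: fps_X_def)
  then show "fps_nth (fps_eval y fps_X) n = fps_nth fps_X n" by (auto simp: fps_X_def)
qed

lemma fps_eval_embed: "fps_eval y (fps_embed H) = H"
proof (rule fps_ext)
  fix n
  have "fps_nth (fps_eval y (fps_embed H)) n = (\<Sum>i\<le>n. if i = n then fps_nth H n else 0)"
    unfolding fps_eval_def fps_embed_def by (auto intro!: sum.cong)
  then show "fps_nth (fps_eval y (fps_embed H)) n = fps_nth H n" by simp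
qed

lemma fps_eval_cong:
  assumes "\<And>i. i < n \<Longrightarrow> fps_nth y i = fps_nth y' i" "k < n"
  shows "fps_nth (fps_eval y F) k = fps_nth (fps_eval y' F) k"
  unfolding fps_eval_def fps_nth_Abs_fps
  by (intro sum.cong refl fps_compose_cong[of k]) (use assms in auto)

definition fps_cderiv :: "real fps fps \<Rightarrow> real fps fps" where
  "fps_cderiv F = Abs_fps (\<lambda>n. fps_deriv (fps_nth F n))"

lemma fps_cderiv_add: "fps_cderiv (F + K) = fps_cderiv F + fps_cderiv K"
  and fps_cderiv_diff: "fps_cderiv (F - K) = fps_cderiv F - fps_cderiv K"
  and fps_cderiv_const: "fps_cderiv (fps_const f) = fps_const (fps_deriv f)"
  and fps_cderiv_0: "fps_cderiv 0 = 0"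
  and fps_cderiv_1: "fps_cderiv 1 = 0"
  and fps_cderiv_X: "fps_cderiv fps_X = 0"
  and fps_cderiv_embed: "fps_cderiv (fps_embed H) = 0"
  by (auto intro!: fps_ext simp: fps_cderiv_def fps_embed_def fps_X_def fps_const_def)

lemma fps_cderiv_mult: "fps_cderiv (F * K) = fps_cderiv F * K + F * fps_cderiv K"
  by (rule fps_ext) (simp add: fps_cderiv_def fps_mult_nth fps_deriv_sum sum.distrib[symmetric] add.commute)

section \<open>Generating functions and the kernel method\<close>

text \<open>
  The catalytic variable marking the width is written \<open>x = 1 + s\<close>, so that evaluating at a series
  \<open>x = Y(t)\<close> with constant term 1 is a legal composition of power series in \<open>s\<close>.
\<close>

definition weighted_gf :: "(tree \<Rightarrow> real) \<Rightarrow> real fps fps" where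
  "weighted_gf f = Abs_fps (\<lambda>n. \<Sum>t\<in>trees n. fps_const (f t) * (1 + fps_X) ^ width t)"

definition total_gf :: "(tree \<Rightarrow> real) \<Rightarrow> real fps" where
  "total_gf f = Abs_fps (\<lambda>n. \<Sum>t\<in>trees n. f t)"

abbreviation s_var :: "real fps fps" where "s_var \<equiv> fps_const fps_X"

lemma geometric_fps:
  "fps_X * (\<Sum>c=1..Suc w. (1 + fps_X) ^ c) = (1 + fps_X) * ((1 + fps_X) * (1 + fps_X) ^ w - (1 :: real fps))"
  by (induction w) (simp_all add: algebra_simps)

lemma fps_const_sum: "fps_const (\<Sum>a\<in>A. f a) = (\<Sum>a\<in>A. fps_const (f a))"
  by (rule fps_ext) (simp add: fps_sum_nth)

text \<open>By \<open>geometric_fps\<close> the sum over labels is a divided difference; multiplying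
  by s keeps it among power series, and \<open>total_gf a\<close> is the value at x = 1. Separate
  weights for the two subtrees serve both later equations, since \<open>cells\<close> of a node is a
  term in \<open>z\<close> plus a term in \<open>x\<close>.\<close>

lemma node_sum_gf:
  "fps_X * (\<Sum>i\<le>n. \<Sum>z\<in>trees i. \<Sum>x\<in>trees (n - i). \<Sum>c=1..Suc (width z).
      fps_const (a z * b x) * (1 + fps_X) ^ width (Node c z x)) =
    fps_nth ((1 + s_var) * ((1 + s_var) * weighted_gf a - fps_embed (total_gf a)) * weighted_gf b) n"
proof -
  have "fps_nth ((1 + s_var) * ((1 + s_var) * weighted_gf a - fps_embed (total_gf a)) * weighted_gf b) n =
     (\<Sum>i\<le>n. ((1 + fps_X) * ((1 + fps_X) * (\<Sum>z\<in>trees i. fps_const (a z) * (1 + fps_X) ^ width z)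
        - fps_const (\<Sum>z\<in>trees i. a z))) * (\<Sum>x\<in>trees (n - i). fps_const (b x) * (1 + fps_X) ^ width x))"
    unfolding fps_mult_nth[of _ "weighted_gf b"] atMost_atLeast0
    by (rule sum.cong) (simp_all add: weighted_gf_def fps_embed_def total_gf_def distrib_right)
  also have "\<dots> = (\<Sum>i\<le>n. (\<Sum>z\<in>trees i. fps_const (a z) * ((1 + fps_X) * ((1 + fps_X) * (1 + fps_X) ^ width z - 1)))
        * (\<Sum>x\<in>trees (n - i). fps_const (b x) * (1 + fps_X) ^ width x))"
    by (intro sum.cong refl arg_cong2[of _ _ _ _ "(*)"])
      (simp add: sum_distrib_left sum_subtractf algebra_simps fps_const_sum flip: sum.distrib)
  also have "\<dots> = (\<Sum>i\<le>n. (\<Sum>z\<in>trees i. fps_const (a z) * (fps_X * (\<Sum>c=1..Suc (width z). (1 + fps_X) ^ c)))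
        * (\<Sum>x\<in>trees (n - i). fps_const (b x) * (1 + fps_X) ^ width x))"
    by (simp only: geometric_fps)
  also have "\<dots> = fps_X * (\<Sum>i\<le>n. \<Sum>z\<in>trees i. \<Sum>x\<in>trees (n - i). \<Sum>c=1..Suc (width z).
      fps_const (a z * b x) * (1 + fps_X) ^ width (Node c z x))"
    unfolding sum_product
    unfolding sum_distrib_left sum_distrib_right width.simps power_add fps_const_mult[symmetric]
    by (intro sum.cong refl) (simp only: ac_simps)
  finally show ?thesis ..
qed

lemma weighted_gf_0: "fps_nth (weighted_gf f) 0 = fps_const (f Tip)"
  by (simp add: weighted_gf_def trees_0)

lemma weighted_gf_Suc:
  "fps_nth (weighted_gf f) (Suc n) =
    (\<Sum>i\<le>n. \<Sum>z\<in>trees i. \<Sum>x\<in>trees (n - i). \<Sum>c=1..Suc (width z).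
      fps_const (f (Node c z x)) * (1 + fps_X) ^ width (Node c z x))"
  unfolding weighted_gf_def fps_nth_Abs_fps by (rule sum_trees_Suc)

definition width_gf :: "real fps fps" where "width_gf = weighted_gf (\<lambda>_. 1)"
definition cells_gf :: "real fps fps" where "cells_gf = weighted_gf (\<lambda>t. real (cells t))"
definition fish_cells_gf :: "real fps fps" where "fish_cells_gf = weighted_gf (\<lambda>t. real (width t + cells t))"
definition count_gf :: "real fps" where "count_gf = total_gf (\<lambda>_. 1)"
definition total_area_gf :: "real fps" where "total_area_gf = total_gf (\<lambda>t. real (width t + cells t))"

lemma width_gf_equation:
  "s_var * width_gf = s_var + fps_X * ((1 + s_var) * ((1 + s_var) * width_gf - fps_embed count_gf) * width_gf)"
proof (rule fps_ext)
  fix n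
  show "fps_nth (s_var * width_gf) n = fps_nth (s_var + fps_X * ((1 + s_var) * ((1 + s_var) * width_gf - fps_embed count_gf) * width_gf)) n"
  proof (cases n)
    case 0
    then show ?thesis by (simp add: width_gf_def weighted_gf_0)
  next
    case (Suc m)
    have "fps_nth (s_var * width_gf) n = fps_X * fps_nth width_gf (Suc m)" by (simp add: Suc)
    also have "\<dots> = fps_nth ((1 + s_var) * ((1 + s_var) * width_gf - fps_embed count_gf) * width_gf) m"
      unfolding width_gf_def count_gf_def weighted_gf_Suc node_sum_gf[symmetric] by simp
    finally show ?thesis by (simp add: Suc)
  qed
qed

lemma cells_gf_equation:
  "s_var * cells_gf = fps_X * ((1 + s_var) * ((1 + s_var) * fish_cells_gf - fps_embed total_area_gf) * width_gf)
     + fps_X * ((1 + s_var) * ((1 + s_var) * width_gf - fps_embed count_gf) * cells_gf)"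
proof (rule fps_ext)
  fix n
  show "fps_nth (s_var * cells_gf) n = fps_nth (fps_X * ((1 + s_var) * ((1 + s_var) * fish_cells_gf - fps_embed total_area_gf) * width_gf)
     + fps_X * ((1 + s_var) * ((1 + s_var) * width_gf - fps_embed count_gf) * cells_gf)) n"
  proof (cases n)
    case 0
    then show ?thesis by (simp add: cells_gf_def weighted_gf_0)
  next
    case (Suc m)
    have "fps_nth (s_var * cells_gf) n = fps_X * fps_nth cells_gf (Suc m)" by (simp add: Suc)
    also have "\<dots> = fps_nth ((1 + s_var) * ((1 + s_var) * fish_cells_gf - fps_embed total_area_gf) * width_gf) m +
        fps_nth ((1 + s_var) * ((1 + s_var) * width_gf - fps_embed count_gf) * cells_gf) m"
      unfolding width_gf_def count_gf_def cells_gf_def fish_cells_gf_def total_area_gf_def weighted_gf_Suc node_sum_gf[symmetric]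
      by (simp add: sum.distrib distrib_left distrib_right del: sum.cl_ivl_Suc flip: fps_const_add)
    finally show ?thesis by (simp add: Suc)
  qed
qed

text \<open>The operator x d/dx brings the width down as a factor; this is how the derivative of
  \<open>width_gf\<close> enters the area.\<close>

lemma fish_cells_gf_eq: "fish_cells_gf = cells_gf + (1 + s_var) * fps_cderiv width_gf"
proof (rule fps_ext)
  fix n
  have "(1 + fps_X) * fps_deriv ((1 + fps_X) ^ k) = fps_const (real k) * (1 + fps_X :: real fps) ^ k" for k
  proof (cases k)
    case (Suc j)
    have "fps_deriv ((1 + fps_X) ^ k) = fps_const (real k) * (1 + fps_X :: real fps) ^ j"
      by (simp add: fps_deriv_power Suc del: power_Suc of_nat_Suc)
    then show ?thesis by (simp only: Suc power_Suc ac_simps)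
  qed simp
  note deriv = this
  have one_s: "fps_nth ((1 + s_var) * F) n = (1 + fps_X) * fps_nth F n" for F
    by (simp add: distrib_right)
  have "fps_nth fish_cells_gf n = (\<Sum>t\<in>trees n. fps_const (real (cells t)) * (1 + fps_X) ^ width t +
      (1 + fps_X) * fps_deriv ((1 + fps_X) ^ width t))"
    unfolding deriv
    by (simp add: fish_cells_gf_def weighted_gf_def distrib_right add.commute flip: fps_const_add)
  also have "\<dots> = fps_nth (cells_gf + (1 + s_var) * fps_cderiv width_gf) n"
    unfolding fps_add_nth one_s
    by (simp add: cells_gf_def width_gf_def weighted_gf_def fps_cderiv_def fps_deriv_sum sum_distrib_left sum.distrib)
  finally show "fps_nth fish_cells_gf n = fps_nth (cells_gf + (1 + s_var) * fps_cderiv width_gf) n" .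
qed

text \<open>The kernel is the derivative of the quadratic equation with respect to G, namely s - t x
  (x G - G(1)) - t x^2 G. By the equation itself, G times the kernel equals s - t x^2 G^2. So a root
  is a solution of y = t (1 + y)^2 G(1 + y)^2, and the explicit factor t makes this a fixed-point
  equation.\<close>

lemma area_gf_algebraic:
  obtains Y \<delta> :: "real fps" where
    "Y = 1 + fps_X * Y ^ 4" "count_gf = 2 * Y ^ 2 - Y ^ 3"
    "\<delta> = fps_X * Y ^ 3 * (1 + \<delta>) ^ 2" "total_area_gf = Y ^ 2 * \<delta>"
proof -
  \<comment> \<open>The kernel: at \<open>x = 1 + y\<close> the coefficient of the unknown derivative vanishes.\<close>
  obtain y where y: "fps_X * ((1 + y) ^ 2 * fps_eval y width_gf ^ 2) = y"
  proof (rule fps_fixed_point[of "\<lambda>y. fps_X * ((1 + y) ^ 2 * fps_eval y width_gf ^ 2)"])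
    fix a b :: "real fps" and n
    assume ab: "\<And>i. i < n \<Longrightarrow> fps_nth a i = fps_nth b i"
    show "fps_nth (fps_X * ((1 + a) ^ 2 * fps_eval a width_gf ^ 2)) n = fps_nth (fps_X * ((1 + b) ^ 2 * fps_eval b width_gf ^ 2)) n"
    proof (cases n)
      case (Suc m)
      have "fps_nth ((1 + a) ^ 2 * fps_eval a width_gf ^ 2) m = fps_nth ((1 + b) ^ 2 * fps_eval b width_gf ^ 2) m"
        by (intro fps_mult_cong[of m] fps_power_cong[of m] fps_eval_cong[of n]) (use ab Suc in auto)
      then show ?thesis by (simp add: Suc)
    qed simp
  qed
  have y0: "fps_nth y 0 = 0" by (subst y[symmetric]) simp
  define Y where "Y = 1 + y"
  define \<gamma> where "\<gamma> = fps_eval y width_gf"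
  define \<delta> where "\<delta> = fps_eval y (fps_cderiv width_gf)"
  define \<epsilon> where "\<epsilon> = fps_eval y (fps_cderiv (fps_cderiv width_gf))"
  define \<kappa> where "\<kappa> = fps_eval y cells_gf"
  define \<Delta> where "\<Delta> = fps_eval y fish_cells_gf"
  note ev = fps_eval_add fps_eval_diff fps_eval_mult[OF y0] fps_eval_0 fps_eval_1 fps_eval_X fps_eval_embed
    fps_eval_const fps_X_fps_compose_startby0[OF y0]
  note folds = Y_def[symmetric] \<gamma>_def[symmetric] \<delta>_def[symmetric] \<epsilon>_def[symmetric] \<kappa>_def[symmetric] \<Delta>_def[symmetric]
  have sd: "fps_cderiv s_var = 1" by (simp add: fps_cderiv_const)
  note cd = fps_cderiv_add fps_cderiv_diff fps_cderiv_mult fps_cderiv_0 fps_cderiv_1 fps_cderiv_X fps_cderiv_embed sd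
  let ?t = "fps_X :: real fps"
  have K: "?t * (Y ^ 2 * \<gamma> ^ 2) = y" using y unfolding folds .
  have E0: "y * \<gamma> = y + ?t * (Y * (Y * \<gamma> - count_gf) * \<gamma>)"
    using arg_cong[OF width_gf_equation, of "fps_eval y"] unfolding ev folds .
  have E1: "\<gamma> + y * \<delta> = 1 + ?t * ((Y * \<gamma> - count_gf) * \<gamma> + Y * (\<gamma> + Y * \<delta>) * \<gamma> + Y * (Y * \<gamma> - count_gf) * \<delta>)"
    using arg_cong[OF width_gf_equation, of "\<lambda>F. fps_eval y (fps_cderiv F)"] unfolding cd ev folds
    by (simp add: algebra_simps)
  have E2: "2 * \<delta> + y * \<epsilon> = ?t * (2 * (\<gamma> + Y * \<delta>) * \<gamma> + 2 * (Y * \<gamma> - count_gf) * \<delta>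
      + Y * (2 * \<delta> + Y * \<epsilon>) * \<gamma> + 2 * Y * (\<gamma> + Y * \<delta>) * \<delta> + Y * (Y * \<gamma> - count_gf) * \<epsilon>)"
    using arg_cong[OF width_gf_equation, of "\<lambda>F. fps_eval y (fps_cderiv (fps_cderiv F))"] unfolding cd ev folds
    by (simp add: algebra_simps)
  have E3: "y * \<kappa> = ?t * (Y * (Y * \<Delta> - total_area_gf) * \<gamma>) + ?t * (Y * (Y * \<gamma> - count_gf) * \<kappa>)"
    using arg_cong[OF cells_gf_equation, of "fps_eval y"] unfolding ev folds .
  have E4: "\<Delta> = \<kappa> + Y * \<delta>"
    using arg_cong[OF fish_cells_gf_eq, of "fps_eval y"] unfolding ev folds .
  have Y_eq: "y = Y - 1" by (simp add: Y_def)
  have \<gamma>0: "fps_nth \<gamma> 0 = 1"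
    by (simp add: \<gamma>_def fps_eval_def width_gf_def weighted_gf_0)
  have Y0: "fps_nth Y 0 = 1" by (simp add: Y_def y0)
  have nz: "\<gamma> \<noteq> 0" "Y \<noteq> 0" using \<gamma>0 Y0 by auto
  have "y \<noteq> 0" unfolding K[symmetric] using nz by simp
  \<comment> \<open>The factor in parentheses multiplies \<open>\<delta>\<close> in \<open>E1\<close> and \<open>\<epsilon>\<close> in \<open>E2\<close>; as it vanishes, \<open>E1\<close> determines
     \<open>\<gamma>\<close>, and \<open>E2\<close> becomes a quadratic equation for \<open>\<delta>\<close>.\<close>
  have "\<gamma> * (y - ?t * (Y * (Y * \<gamma> - count_gf)) - ?t * (Y ^ 2 * \<gamma>)) = 0"
    using E0 K by (simp add: algebra_simps power2_eq_square)
  then have PG: "y - ?t * (Y * (Y * \<gamma> - count_gf)) - ?t * (Y ^ 2 * \<gamma>) = 0"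
    using nz by simp
  have "\<gamma> - 1 - ?t * \<gamma> * (2 * Y * \<gamma> - count_gf) = - \<delta> * (y - ?t * (Y * (Y * \<gamma> - count_gf)) - ?t * (Y ^ 2 * \<gamma>))"
    using E1 by (simp add: algebra_simps power2_eq_square)
  then have "\<gamma> - 1 = ?t * \<gamma> * (2 * Y * \<gamma> - count_gf)" unfolding PG by simp
  \<comment> \<open>The factor \<open>Y\<close> completes the terms of the kernel, whose vanishing
    replaces them by \<open>y = Y - 1\<close>.\<close>
  then have "Y * (\<gamma> - 1) = Y * (?t * \<gamma> * (2 * Y * \<gamma> - count_gf))"
    by (rule arg_cong)
  also have "\<dots> = \<gamma> * (?t * (Y * (Y * \<gamma> - count_gf)) + ?t * (Y ^ 2 * \<gamma>))"
    by (simp add: algebra_simps power2_eq_square)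
  also have "?t * (Y * (Y * \<gamma> - count_gf)) + ?t * (Y ^ 2 * \<gamma>) = y" using PG by (simp add: algebra_simps)
  finally have \<gamma>: "\<gamma> = Y" by (simp add: Y_eq algebra_simps)
  have Y4: "Y = 1 + ?t * Y ^ 4"
    using K unfolding \<gamma> Y_eq by (simp add: algebra_simps eval_nat_numeral)
  have "?t * Y * (Y ^ 3 - (2 * Y ^ 2 - count_gf)) = 0"
    using PG K unfolding \<gamma> by (simp add: algebra_simps eval_nat_numeral)
  then have "Y ^ 3 - (2 * Y ^ 2 - count_gf) = 0" using nz by (metis mult_eq_0_iff fps_X_neq_zero)
  then have H: "count_gf = 2 * Y ^ 2 - Y ^ 3" by (simp add: algebra_simps)
  have "2 * \<delta> - ?t * (2 * (Y + Y * \<delta>) * Y + 2 * (Y * Y - count_gf) * \<delta> + 2 * Y * \<delta> * Y + 2 * Y * (Y + Y * \<delta>) * \<delta>)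
      = - \<epsilon> * (y - ?t * (Y * (Y * \<gamma> - count_gf)) - ?t * (Y ^ 2 * \<gamma>))"
    using E2 unfolding \<gamma> by (simp add: algebra_simps power2_eq_square)
  then have "2 * (\<delta> - ?t * ((Y + Y * \<delta>) * Y + (Y * Y - count_gf) * \<delta> + Y * \<delta> * Y + Y * (Y + Y * \<delta>) * \<delta>)) = 0"
    unfolding PG by (simp add: algebra_simps)
  then have "\<delta> = ?t * ((Y + Y * \<delta>) * Y + (Y * Y - count_gf) * \<delta> + Y * \<delta> * Y + Y * (Y + Y * \<delta>) * \<delta>)"
    by simp
  then have "\<delta> * (1 - ?t * Y ^ 3) = ?t * Y ^ 2 * (1 + \<delta>) ^ 2"
    unfolding H by (simp add: algebra_simps eval_nat_numeral)
  \<comment> \<open>Multiplying by \<open>Y\<close> clears the factor on the left, because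
    \<open>Y * (1 - t * Y ^ 3) = 1\<close> restates the equation of \<open>Y\<close>.\<close>
  from arg_cong[OF this, of "\<lambda>u. Y * u"]
  have "\<delta> * (Y * (1 - ?t * Y ^ 3)) = ?t * Y ^ 3 * (1 + \<delta>) ^ 2"
    by (simp add: algebra_simps eval_nat_numeral)
  moreover have "Y * (1 - ?t * Y ^ 3) = 1"
    using Y4 by (simp add: algebra_simps eval_nat_numeral)
  ultimately have \<delta>: "\<delta> = ?t * Y ^ 3 * (1 + \<delta>) ^ 2" by simp
  \<comment> \<open>The area equation has two unknowns, \<open>\<kappa>\<close> and the total area.
    After multiplication by \<open>\<gamma>\<close>, E0 and then K turn it into
    \<open>Y * \<kappa> = Y * \<Delta> - total_area_gf\<close>, and \<open>\<kappa>\<close> cancels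
    by E4.\<close>
  have E0': "?t * (Y * (Y * \<gamma> - count_gf) * \<gamma>) = y * \<gamma> - y"
    by (subst E0) simp
  have "\<gamma> * (y * \<kappa>) = ?t * Y * (Y * \<Delta> - total_area_gf) * \<gamma> ^ 2 + (?t * (Y * (Y * \<gamma> - count_gf) * \<gamma>)) * \<kappa>"
    using arg_cong[OF E3, of "\<lambda>u. \<gamma> * u"] by (simp add: algebra_simps power2_eq_square)
  then have "\<gamma> * (y * \<kappa>) = ?t * Y * (Y * \<Delta> - total_area_gf) * \<gamma> ^ 2 + (y * \<gamma> - y) * \<kappa>"
    unfolding E0' .
  then have "y * \<kappa> = ?t * Y * (Y * \<Delta> - total_area_gf) * \<gamma> ^ 2"
    by (simp add: algebra_simps)
  from arg_cong[OF this, of "\<lambda>u. Y * u"]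
  have "Y * (y * \<kappa>) = (Y * \<Delta> - total_area_gf) * (?t * (Y ^ 2 * \<gamma> ^ 2))"
    by (simp add: algebra_simps power2_eq_square)
  then have "y * (Y * \<kappa> - (Y * \<Delta> - total_area_gf)) = 0" unfolding K by (simp add: algebra_simps)
  with \<open>y \<noteq> 0\<close> have "total_area_gf = Y ^ 2 * \<delta>" unfolding E4 by (simp add: algebra_simps power2_eq_square)
  with Y4 H \<delta> show ?thesis by (rule that)
qed

section \<open>Extraction of the coefficients\<close>

lemma fps_mult_compose_nth:
  fixes a b f :: "real fps"
  assumes "fps_nth b 0 = 0"
  shows "fps_nth (f * (a oo b)) n = (\<Sum>i=0..n. fps_nth a i * fps_nth (f * b ^ i) n)"
proof -
  have "fps_nth (a oo b) m = (\<Sum>i=0..n. fps_nth a i * fps_nth (b ^ i) m)" if "m \<le> n" for m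
    unfolding fps_compose_nth
    by (rule sum.mono_neutral_left) (use that startsby_zero_power_prefix[OF assms] in auto)
  then have "fps_nth (f * (a oo b)) n = (\<Sum>j=0..n. fps_nth f j * (\<Sum>i=0..n. fps_nth a i * fps_nth (b ^ i) (n - j)))"
    by (simp add: fps_mult_nth)
  also have "\<dots> = (\<Sum>i=0..n. fps_nth a i * fps_nth (f * b ^ i) n)"
    unfolding fps_mult_nth sum_distrib_left by (subst sum.swap) (simp add: ac_simps)
  finally show ?thesis .
qed

lemma sum_area_trees:
  "(\<Sum>t\<in>trees n. real (width t + cells t)) =
    (\<Sum>m=1..n. real ((2 * m + 1) choose m) / real (2 * m + 1) *
       (real (3 * m + 2) / real (4 * n - m + 2) * real ((4 * n - m + 2) choose (n - m))))"
  and card_trees: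
  "real (card (trees n)) = 4 / real (4 * n + 2) * real ((4 * n + 2) choose n)
     - 3 / real (4 * n + 3) * real ((4 * n + 3) choose n)"
proof -
  obtain Y \<delta> :: "real fps" where Y: "Y = 1 + fps_X * Y ^ 4" and H: "count_gf = 2 * Y ^ 2 - Y ^ 3"
    and \<delta>: "\<delta> = fps_X * Y ^ 3 * (1 + \<delta>) ^ 2" and A: "total_area_gf = Y ^ 2 * \<delta>"
    by (rule area_gf_algebraic)
  obtain Q :: "real fps" where "1 + fps_X * Q ^ 2 = Q"
  proof (rule fps_fixed_point[of "\<lambda>a. 1 + fps_X * a ^ 2"])
    fix a b :: "real fps" and n
    assume ab: "\<And>i. i < n \<Longrightarrow> fps_nth a i = fps_nth b i"
    show "fps_nth (1 + fps_X * a ^ 2) n = fps_nth (1 + fps_X * b ^ 2) n"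
    proof (cases n)
      case (Suc m)
      have "fps_nth (a ^ 2) m = fps_nth (b ^ 2) m"
        by (rule fps_power_cong[of m]) (use ab Suc in auto)
      then show ?thesis by (simp add: Suc)
    qed simp
  qed
  then have Q: "Q = 1 + fps_X * Q ^ 2" by simp
  let ?z = "fps_X * Y ^ 3"
  have z0: "fps_nth ?z 0 = 0" by simp
  define q where "q = Q oo ?z"
  have q: "q = 1 + ?z * q ^ 2"
    unfolding q_def fps_compose_power[OF z0]
    by (subst Q) (simp add: fps_compose_add_distrib fps_compose_mult_distrib[OF z0] z0)
  \<comment> \<open>Both \<open>1 + \<delta>\<close> and \<open>q\<close> solve
    \<open>u = 1 + z u^2\<close>. Subtracting the equations factors them, and the second factor has
    constant term 1, so the solutions agree.\<close>
  have "(1 + \<delta> - q) * (1 - ?z * (1 + \<delta> + q)) = 0"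
    using q \<delta> by (simp add: algebra_simps power2_eq_square)
  moreover have "fps_nth (1 - ?z * (1 + \<delta> + q)) 0 = 1" by simp
  then have "1 - ?z * (1 + \<delta> + q) \<noteq> 0" by (metis fps_zero_nth zero_neq_one)
  ultimately have "1 + \<delta> - q = 0" by (metis mult_eq_0_iff)
  then have "\<delta> = q - 1" by (simp add: algebra_simps)
  then have "total_area_gf = Y ^ 2 * ((Q - 1) oo ?z)"
    by (simp add: A q_def fps_compose_sub_distrib)
  then have "fps_nth total_area_gf n = (\<Sum>m=0..n. fps_nth (Q - 1) m * fps_nth (Y ^ 2 * ?z ^ m) n)"
    using fps_mult_compose_nth[OF z0, of "Y ^ 2" "Q - 1" n] by (simp only:)
  also have "\<dots> = (\<Sum>m=1..n. fps_nth (Q - 1) m * fps_nth (Y ^ 2 * ?z ^ m) n)"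
    by (rule sum.mono_neutral_right) (auto simp: not_less_eq_eq, subst Q, simp)
  also have "\<dots> = (\<Sum>m=1..n. real ((2 * m + 1) choose m) / real (2 * m + 1) *
       (real (3 * m + 2) / real (4 * n - m + 2) * real ((4 * n - m + 2) choose (n - m))))"
  proof (rule sum.cong, goal_cases)
    case (2 m)
    have "Y ^ 2 * ?z ^ m = fps_X ^ m * Y ^ (3 * m + 2)"
      by (simp add: power_mult_distrib power_add power2_eq_square algebra_simps flip: power_mult)
    moreover have "4 * (n - m) + (3 * m + 2) = 4 * n - m + 2" using 2 by auto
    ultimately have "fps_nth (Y ^ 2 * ?z ^ m) n =
        real (3 * m + 2) / real (4 * n - m + 2) * real ((4 * n - m + 2) choose (n - m))"
      using 2 raney[OF Y, of "3 * m + 2" "n - m"] by (simp add: fps_X_power_mult_nth)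
    moreover have "fps_nth (Q - 1) m = real ((2 * m + 1) choose m) / real (2 * m + 1)"
      using 2 raney[OF Q, of 1 m] by simp
    ultimately show ?case by simp
  qed simp
  finally show "(\<Sum>t\<in>trees n. real (width t + cells t)) =
    (\<Sum>m=1..n. real ((2 * m + 1) choose m) / real (2 * m + 1) *
       (real (3 * m + 2) / real (4 * n - m + 2) * real ((4 * n - m + 2) choose (n - m))))"
    by (simp add: total_area_gf_def total_gf_def)
  have "real (card (trees n)) = fps_nth count_gf n" by (simp add: count_gf_def total_gf_def)
  also have "\<dots> = 2 * fps_nth (Y ^ 2) n - fps_nth (Y ^ 3) n"
    by (simp add: H fps_numeral_nth fps_numeral_fps_const)
  finally show "real (card (trees n)) = 4 / real (4 * n + 2) * real ((4 * n + 2) choose n)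
     - 3 / real (4 * n + 3) * real ((4 * n + 3) choose n)"
    using raney[OF Y, of 2 n] raney[OF Y, of 3 n] by simp
qed

section \<open>Asymptotics of the coefficients\<close>

lemma Gamma_quarter: "Gamma (1/4 :: real) * Gamma (3/4) = pi * sqrt 2"
proof -
  have "complex_of_real (Gamma (1/4) * Gamma (3/4)) = Gamma (complex_of_real (1/4)) * Gamma (1 - complex_of_real (1/4))"
    by (simp add: Gamma_complex_of_real[symmetric])
  also have "\<dots> = complex_of_real (pi / sin (pi * (1/4)))"
    by (subst Gamma_reflection_complex) (simp add: sin_of_real[symmetric])
  finally have "Gamma (1/4 :: real) * Gamma (3/4) = pi / sin (pi / 4)"
    by (simp only: of_real_eq_iff) simp
  also have "\<dots> = pi * (2 / sqrt 2)" by (simp add: sin_45)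
  also have "2 / sqrt 2 = sqrt (2 :: real)" by (simp add: real_div_sqrt)
  finally show ?thesis .
qed

text \<open>Euler's integral for Gamma(1/4) under the substitution \<open>t = c v^2\<close>. It is
  used with \<open>c = 3/8\<close> for the limit and with \<open>c = 1/4\<close> for the
  majorant.\<close>

lemma has_integral_powr_exp_square:
  fixes c :: real
  assumes "c > 0"
  shows "((\<lambda>v. v powr (-1/2) * exp (- (c * v\<^sup>2))) has_integral Gamma (1/4) / (2 * c powr (1/4))) {0<..}"
proof -
  let ?f = "\<lambda>t::real. t powr (1/4 - 1) / exp t"
  have "(?f has_integral Gamma (1/4)) {0<..}"
    using Gamma_integral_real[of "1/4"]
    by (subst has_integral_spike_set_eq[of "{0<..}" "{0..}"])
      (auto intro: negligible_subset[of "{0}"])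
  moreover have "?f absolutely_integrable_on {0<..}"
    by (rule nonnegative_absolutely_integrable_1) (use calculation in auto)
  moreover have img: "(\<lambda>v. c * v\<^sup>2) ` {0<..} = {0<..}"
  proof (intro equalityI subsetI)
    fix t :: real assume "t \<in> {0<..}"
    then have "t = c * (sqrt (t / c))\<^sup>2" "sqrt (t / c) > 0" using assms by auto
    then show "t \<in> (\<lambda>v. c * v\<^sup>2) ` {0<..}" by blast
  qed (use assms in auto)
  ultimately have F: "?f absolutely_integrable_on (\<lambda>v. c * v\<^sup>2) ` {0<..} \<and>
      integral ((\<lambda>v. c * v\<^sup>2) ` {0<..}) ?f = Gamma (1/4)"
    by (auto simp: integral_unique)
  have "(\<lambda>v. \<bar>2 * c * v\<bar> * ?f (c * v\<^sup>2)) absolutely_integrable_on {0<..} \<and>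
      integral {0<..} (\<lambda>v. \<bar>2 * c * v\<bar> * ?f (c * v\<^sup>2)) = Gamma (1/4)"
  proof (subst has_absolute_integral_change_of_variables_1'[where g = "\<lambda>v. c * v\<^sup>2"])
    show "inj_on (\<lambda>v. c * v\<^sup>2) {0<..}"
      using assms by (auto simp: inj_on_def power2_eq_iff)
    show "((\<lambda>v. c * v\<^sup>2) has_real_derivative 2 * c * x) (at x within {0<..})" for x
      by (auto intro!: derivative_eq_intros)
  qed (use F in auto)
  then have "((\<lambda>v. \<bar>2 * c * v\<bar> * ?f (c * v\<^sup>2)) has_integral Gamma (1/4)) {0<..}"
    unfolding has_integral_integrable_integral absolutely_integrable_on_def by blast
  then have "((\<lambda>v. 2 * c powr (1/4) * (v powr (-1/2) * exp (- (c * v\<^sup>2)))) has_integral Gamma (1/4)) {0<..}"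
  proof (rule has_integral_eq[rotated])
    fix v :: real assume v: "v \<in> {0<..}"
    have 1: "(c * v\<^sup>2) powr (1/4 - 1) = c powr (-3/4) * v powr (-3/2)"
      using v assms by (simp add: powr_mult powr_powr flip: powr_numeral)
    have 2: "c * c powr (-3/4) = c powr (1/4)"
      using assms powr_mult_base[of c "-3/4"] by simp
    have 3: "v * v powr (-3/2) = v powr (-1/2)"
      using v powr_mult_base[of v "-3/2"] by simp
    have "\<bar>2 * c * v\<bar> * ?f (c * v\<^sup>2) = 2 * c * v * ((c * v\<^sup>2) powr (1/4 - 1) / exp (c * v\<^sup>2))"
      using v assms by simp
    also have "\<dots> = 2 * (c * c powr (-3/4)) * ((v * v powr (-3/2)) * exp (- (c * v\<^sup>2)))"
      unfolding 1 by (simp only: exp_minus divide_inverse ac_simps)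
    finally show "\<bar>2 * c * v\<bar> * ?f (c * v\<^sup>2) = 2 * c powr (1/4) * (v powr (-1/2) * exp (- (c * v\<^sup>2)))"
      unfolding 2 3 .
  qed
  from has_integral_mult_right[OF this, of "1 / (2 * c powr (1/4))"] show ?thesis
    using assms by simp
qed

text \<open>With \<open>c = sqrt n\<close> this puts the sums for all \<open>n\<close> on the common
  domain \<open>{0<..}\<close>. The ceiling equals \<open>m\<close> exactly on the interval from
  \<open>(m - 1) / c\<close>, excluded, to \<open>m / c\<close>, included.\<close>

lemma has_integral_step_function:
  fixes g :: "nat \<Rightarrow> real"
  assumes "c > 0" and g: "\<And>m. m \<notin> {1..n} \<Longrightarrow> g m = 0"
  shows "((\<lambda>v. g (nat \<lceil>v * c\<rceil>)) has_integral (\<Sum>m=1..n. g m) / c) {0<..}"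
proof -
  have "((\<lambda>v. \<Sum>m=1..n. if v \<in> {(real m - 1) / c<..real m / c} then g m else 0) has_integral (\<Sum>m=1..n. g m / c)) {0<..}"
  proof (rule has_integral_sum)
    fix m assume m: "m \<in> {1..n}"
    have sub: "{(real m - 1) / c<..real m / c} \<subseteq> {0<..}"
    proof
      fix v assume "v \<in> {(real m - 1) / c<..real m / c}"
      moreover have "(real m - 1) / c \<ge> 0" using m assms by auto
      ultimately show "v \<in> {0<..}" by auto
    qed
    have "((\<lambda>_. g m) has_integral (real m / c - (real m - 1) / c) *\<^sub>R g m) {(real m - 1) / c..real m / c}"
      using has_integral_const_real[of "g m" "(real m - 1) / c" "real m / c"] assms
      by (simp add: divide_right_mono)
    then have "((\<lambda>_. g m) has_integral g m / c) {(real m - 1) / c..real m / c}"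
      by (simp add: diff_divide_distrib)
    then have "((\<lambda>_. g m) has_integral g m / c) {(real m - 1) / c<..real m / c}"
      by (subst has_integral_spike_set_eq[of _ "{(real m - 1) / c..real m / c}"])
        (auto intro: negligible_subset[of "{(real m - 1) / c}"])
    then show "((\<lambda>v. if v \<in> {(real m - 1) / c<..real m / c} then g m else 0) has_integral g m / c) {0<..}"
      using sub by (subst has_integral_restrict)
  qed simp
  moreover have "(\<Sum>m=1..n. if v \<in> {(real m - 1) / c<..real m / c} then g m else 0) = g (nat \<lceil>v * c\<rceil>)"
    if "v \<in> {0<..}" for v
  proof -
    have "v \<in> {(real m - 1) / c<..real m / c} \<longleftrightarrow> m = nat \<lceil>v * c\<rceil>" if "m \<in> {1..n}" for m
    proof -
      have "v \<in> {(real m - 1) / c<..real m / c} \<longleftrightarrow> real m - 1 < v * c \<and> v * c \<le> real m"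
        using assms by (simp add: field_simps)
      also have "\<dots> \<longleftrightarrow> \<lceil>v * c\<rceil> = int m" by (simp add: ceiling_eq_iff)
      also have "\<dots> \<longleftrightarrow> m = nat \<lceil>v * c\<rceil>" using that by auto
      finally show ?thesis .
    qed
    then have "(\<Sum>m=1..n. if v \<in> {(real m - 1) / c<..real m / c} then g m else 0)
        = (\<Sum>m=1..n. if m = nat \<lceil>v * c\<rceil> then g m else 0)"
      by (intro sum.cong refl if_cong) auto
    also have "\<dots> = g (nat \<lceil>v * c\<rceil>)" using g by (simp add: sum.delta')
    finally show ?thesis .
  qed
  ultimately show ?thesis
    by (auto simp: sum_divide_distrib intro: has_integral_eq[rotated])
qed

section \<open>Asymptotics of the Catalan numbers\<close>

text \<open>In this form the Gamma limit of generalised binomials applies with parameter -1/2, and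
  Gamma(1/2) = sqrt pi gives the constant in \<open>catalan_asymp\<close>.\<close>

lemma central_binomial_gchoose: "real ((2 * n) choose n) / 4 ^ n = (real n - 1/2) gchoose n"
proof (induction n)
  case (Suc n)
  have "real (Suc n) * real ((2 * Suc n) choose Suc n) = real (2 * (2 * n + 1)) * real ((2 * n) choose n)"
  proof -
    have "Suc n * ((2 * Suc n) choose Suc n) = 2 * Suc n * ((2 * n + 1) choose n)"
      using Suc_times_binomial_eq[of "2 * n + 1" n] by (simp add: mult.commute)
    moreover have "(n + 1) * ((2 * n + 1) choose n) = (2 * n + 1) * ((2 * n) choose n)"
      using binomial_absorb_comp[of "2 * n + 1" n] by simp
    ultimately have "Suc n * ((2 * Suc n) choose Suc n) = 2 * (2 * n + 1) * ((2 * n) choose n)" by simp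
    then show ?thesis by (metis of_nat_mult)
  qed
  moreover define Q where "Q = real ((2 * Suc n) choose Suc n)"
  ultimately have "(real n + 1) * Q = 2 * (2 * real n + 1) * real ((2 * n) choose n)" by (simp add: add.commute)
  then have "Q = 2 * (2 * real n + 1) / (real n + 1) * real ((2 * n) choose n)"
    by (simp add: field_simps)
  then have "Q / 4 ^ Suc n = (real n + 1/2) / (real n + 1) * (real ((2 * n) choose n) / 4 ^ n)"
    by (simp add: divide_simps) (simp add: algebra_simps)
  also have "\<dots> = (real n - 1/2 + 1) gchoose Suc n"
    unfolding Suc.IH by (subst gbinomial_factors) (simp add: field_simps)
  finally show ?case unfolding Q_def by (simp add: algebra_simps del: binomial_Suc_Suc)
qed simp

definition catalan :: "nat \<Rightarrow> real" where
  "catalan m = real ((2 * m + 1) choose m) / real (2 * m + 1)"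

lemma catalan_eq: "catalan m = real ((2 * m) choose m) / real (m + 1)"
proof -
  have "(m + 1) * ((2 * m + 1) choose m) = (2 * m + 1) * ((2 * m) choose m)"
    using binomial_absorb_comp[of "2 * m + 1" m] by simp
  then have "real (m + 1) * real ((2 * m + 1) choose m) = real (2 * m + 1) * real ((2 * m) choose m)"
    by (metis of_nat_mult)
  then show ?thesis by (simp add: catalan_def field_simps)
qed

lemma catalan_asymp: "(\<lambda>m. catalan m / 4 ^ m * real m powr (3/2)) \<longlonglongrightarrow> 1 / sqrt pi"
proof -
  have "(\<lambda>n. ((real n - 1/2) gchoose n) * exp (1/2 * ln (real n))) \<longlonglongrightarrow> 1 / sqrt pi"
    using Gamma_gbinomial[of "-1/2 :: real"] by (simp add: rGamma_inverse_Gamma Gamma_one_half_real field_simps)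
  moreover have "(\<lambda>n. real n / (real n + 1)) \<longlonglongrightarrow> 1" by real_asymp
  ultimately have "(\<lambda>n. ((real n - 1/2) gchoose n) * exp (1/2 * ln (real n)) * (real n / (real n + 1))) \<longlonglongrightarrow> 1 / sqrt pi * 1"
    by (rule tendsto_mult)
  moreover have "\<forall>\<^sub>F n in sequentially. ((real n - 1/2) gchoose n) * exp (1/2 * ln (real n)) * (real n / (real n + 1)) =
      catalan n / 4 ^ n * real n powr (3/2)"
    using eventually_gt_at_top[of 0]
  proof eventually_elim
    case (elim n)
    have "real n powr (3/2) = real n powr (1/2) * real n"
      using elim powr_mult_base[of "real n" "1/2"] by (simp add: mult.commute)
    moreover have "exp (1/2 * ln (real n)) = real n powr (1/2)"
      using elim by (simp add: powr_def)
    ultimately show ?case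
      unfolding central_binomial_gchoose[symmetric] by (simp add: catalan_eq ac_simps)
  qed
  ultimately show ?thesis by (simp add: tendsto_cong)
qed

section \<open>The Gaussian factor\<close>

definition binomial_ratio :: "nat \<Rightarrow> nat \<Rightarrow> real" where
  "binomial_ratio n m = 4 ^ m * real ((4 * n - m + 2) choose (n - m)) / real ((4 * n + 2) choose n)"

text \<open>Lowering both binomial entries by one multiplies the binomial by
  \<open>(n - m) / (4 * n - m + 2)\<close>, about 1/4, which the power of 4 compensates. The
  deviations \<open>3 * i + 2\<close> sum to about \<open>3 * m^2 / 2\<close>; over
  \<open>4 * n\<close> this is the exponent \<open>3 * m^2 / (8 * n)\<close>.\<close>

lemma binomial_ratio_prod: "m \<le> n \<Longrightarrow> binomial_ratio n m = (\<Prod>i<m. 1 - (3 * real i + 2) / (4 * real n + 2 - real i))"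
proof (induction m)
  case 0
  have "(4 * n + 2) choose n > 0" by (rule zero_less_binomial) simp
  then show ?case by (simp add: binomial_ratio_def)
next
  case (Suc m)
  define M k where "M = 4 * n - Suc m + 2" and "k = n - Suc m"
  have Mk: "Suc M = 4 * n - m + 2" "Suc k = n - m" using Suc.prems by (auto simp: M_def k_def)
  have "real (Suc k) * real (Suc M choose Suc k) = real (Suc M) * real (M choose k)"
    using Suc_times_binomial_eq[of M k] by (metis of_nat_mult mult.commute)
  then have "real (M choose k) = real (Suc k) / real (Suc M) * real (Suc M choose Suc k)"
    by (simp add: field_simps)
  then have "binomial_ratio n (Suc m) = binomial_ratio n m * (4 * real (Suc k) / real (Suc M))"
    unfolding binomial_ratio_def M_def[symmetric] k_def[symmetric] Mk[symmetric]
    by (simp add: ac_simps del: binomial_Suc_Suc of_nat_Suc)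
  also have "4 * real (Suc k) / real (Suc M) = 1 - (3 * real m + 2) / (4 * real n + 2 - real m)"
  proof -
    have "real (Suc M) = 4 * real n + 2 - real m" "real (Suc k) = real n - real m"
      unfolding Mk using Suc.prems by (auto simp: of_nat_diff)
    moreover have "4 * real n + 2 - real m > 0" using Suc.prems by simp
    then have "1 - (3 * real m + 2) / (4 * real n + 2 - real m) = 4 * (real n - real m) / (4 * real n + 2 - real m)"
      by (simp add: divide_simps)
    ultimately show ?thesis by simp
  qed
  finally show ?case using Suc by simp
qed

lemma sum_linear_3i_2: "(\<Sum>i<m. 3 * real i + 2) = (3 * (real m)\<^sup>2 + real m) / 2"
  by (induction m) (simp_all add: field_simps power2_eq_square)

lemma binomial_ratio_upper:
  assumes "m \<le> n"
  shows "binomial_ratio n m \<le> exp (- ((3 * (real m)\<^sup>2 + real m) / 2 / (4 * real n + 2)))"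
proof -
  have "binomial_ratio n m \<le> (\<Prod>i<m. exp (- ((3 * real i + 2) / (4 * real n + 2))))"
    unfolding binomial_ratio_prod[OF assms]
  proof (intro prod_mono conjI)
    fix i assume "i \<in> {..<m}"
    then have i: "real i + 1 \<le> real n" using assms by simp
    show "0 \<le> 1 - (3 * real i + 2) / (4 * real n + 2 - real i)"
      using i by (simp add: field_simps)
    have "(3 * real i + 2) / (4 * real n + 2) \<le> (3 * real i + 2) / (4 * real n + 2 - real i)"
      using i by (intro divide_left_mono) auto
    then have "1 - (3 * real i + 2) / (4 * real n + 2 - real i) \<le> 1 + - ((3 * real i + 2) / (4 * real n + 2))"
      by simp
    also have "\<dots> \<le> exp (- ((3 * real i + 2) / (4 * real n + 2)))" by (rule exp_ge_add_one_self)
    finally show "1 - (3 * real i + 2) / (4 * real n + 2 - real i) \<le> exp (- ((3 * real i + 2) / (4 * real n + 2)))" .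
  qed
  also have "\<dots> = exp (- ((\<Sum>i<m. 3 * real i + 2) / (4 * real n + 2)))"
    by (simp add: exp_sum[symmetric] sum_negf sum_divide_distrib)
  finally show ?thesis by (simp only: sum_linear_3i_2)
qed

text \<open>Uses \<open>ln (1 - e) \<ge> - e - 2 * e^2\<close> for \<open>e \<le> 1/2\<close> in
  each factor; \<open>\<epsilon>\<close> dominates every \<open>e\<close>, so the quadratic error is
  absorbed uniformly into \<open>1 + 2 * \<epsilon>\<close>.\<close>

lemma binomial_ratio_lower:
  assumes "m \<le> n" and \<epsilon>: "\<epsilon> = (3 * real m + 2) / (4 * real n + 2 - real m)" "\<epsilon> \<le> 1/2"
  shows "exp (- ((3 * (real m)\<^sup>2 + real m) / 2 / (4 * real n + 2 - real m) * (1 + 2 * \<epsilon>))) \<le> binomial_ratio n m"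
proof -
  have pos: "4 * real n + 2 - real m > 0" using assms(1) by simp
  have "(\<Prod>i<m. exp (- ((3 * real i + 2) / (4 * real n + 2 - real m) * (1 + 2 * \<epsilon>)))) \<le> binomial_ratio n m"
    unfolding binomial_ratio_prod[OF assms(1)]
  proof (intro prod_mono conjI)
    fix i assume "i \<in> {..<m}"
    then have i: "real i + 1 \<le> real m" "real i + 1 \<le> real n" using assms by auto
    define e where "e = (3 * real i + 2) / (4 * real n + 2 - real i)"
    have e1: "e \<le> (3 * real i + 2) / (4 * real n + 2 - real m)"
      unfolding e_def using i pos by (intro divide_left_mono) auto
    also have "\<dots> \<le> \<epsilon>"
      unfolding \<epsilon> using i pos by (intro divide_right_mono) auto
    finally have e2: "e \<le> \<epsilon>" .
    have e0: "0 \<le> e" unfolding e_def using i by auto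
    have "e * (1 + 2 * e) \<le> (3 * real i + 2) / (4 * real n + 2 - real m) * (1 + 2 * \<epsilon>)"
      using e0 e1 e2 by (intro mult_mono) auto
    then have "- ((3 * real i + 2) / (4 * real n + 2 - real m) * (1 + 2 * \<epsilon>)) \<le> - e - 2 * e\<^sup>2"
      by (simp add: algebra_simps power2_eq_square)
    also have "\<dots> \<le> ln (1 - e)"
      using e0 e2 \<epsilon>(2) by (intro ln_one_minus_pos_lower_bound) auto
    finally have "exp (- ((3 * real i + 2) / (4 * real n + 2 - real m) * (1 + 2 * \<epsilon>))) \<le> exp (ln (1 - e))"
      by simp
    also have "\<dots> = 1 - e" using e2 \<epsilon>(2) by simp
    finally show "exp (- ((3 * real i + 2) / (4 * real n + 2 - real m) * (1 + 2 * \<epsilon>)))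
        \<le> 1 - (3 * real i + 2) / (4 * real n + 2 - real i)" unfolding e_def .
  qed simp
  also have "(\<Prod>i<m. exp (- ((3 * real i + 2) / (4 * real n + 2 - real m) * (1 + 2 * \<epsilon>)))) =
      exp (- ((\<Sum>i<m. 3 * real i + 2) / (4 * real n + 2 - real m) * (1 + 2 * \<epsilon>)))"
    by (simp add: exp_sum[symmetric] sum_negf sum_divide_distrib sum_distrib_right)
  finally show ?thesis by (simp only: sum_linear_3i_2)
qed

context
  fixes v :: real and m :: "nat \<Rightarrow> nat"
  assumes v: "v > 0" and m_def: "\<And>n. m n = nat \<lceil>v * sqrt (real n)\<rceil>"
begin

lemma m_ratio_ge: "n \<ge> 1 \<Longrightarrow> v \<le> real (m n) / sqrt (real n)"
  using v by (simp add: m_def field_simps)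

lemma m_ratio: "(\<lambda>n. real (m n) / sqrt (real n)) \<longlonglongrightarrow> v"
proof (rule tendsto_sandwich)
  show "\<forall>\<^sub>F n in sequentially. v \<le> real (m n) / sqrt (real n)"
    using eventually_ge_at_top[of 1] by eventually_elim (rule m_ratio_ge)
  show "\<forall>\<^sub>F n in sequentially. real (m n) / sqrt (real n) \<le> v + 1 / sqrt (real n)"
    using eventually_gt_at_top[of 0]
  proof eventually_elim
    case (elim n)
    have "real (m n) = of_int \<lceil>v * sqrt (real n)\<rceil>" using v by (simp add: m_def)
    also have "\<dots> \<le> v * sqrt (real n) + 1" by linarith
    finally show ?case using elim by (simp add: field_simps)
  qed
  show "(\<lambda>n. v + 1 / sqrt (real n)) \<longlonglongrightarrow> v" by real_asymp
qed simp

lemma inverse_sqrt_tendsto_0: "(\<lambda>n. 1 / sqrt (real n)) \<longlonglongrightarrow> 0"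
  by real_asymp

lemma m_at_top: "filterlim m at_top sequentially"
proof -
  have "filterlim (\<lambda>n. v * sqrt (real n)) at_top sequentially" using v by real_asymp
  then have "filterlim (\<lambda>n. real (m n)) at_top sequentially"
    by (rule filterlim_at_top_mono) (auto simp: m_def real_nat_ceiling_ge)
  then show ?thesis by (simp add: filterlim_sequentially_iff_filterlim_real)
qed

lemma m_eventually_le: "\<forall>\<^sub>F n in sequentially. m n \<le> n"
proof -
  have "(\<lambda>n. real (m n) / sqrt (real n) * (1 / sqrt (real n))) \<longlonglongrightarrow> v * 0"
    by (intro tendsto_mult m_ratio inverse_sqrt_tendsto_0)
  then have "\<forall>\<^sub>F n in sequentially. real (m n) / sqrt (real n) * (1 / sqrt (real n)) < 1"
    by (intro order_tendstoD) auto
  then show ?thesis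
    using eventually_gt_at_top[of 0]
    by eventually_elim simp
qed

lemma binomial_ratio_limit: "(\<lambda>n. binomial_ratio n (m n)) \<longlonglongrightarrow> exp (- (3/8 * v\<^sup>2))"
proof -
  \<comment> \<open>In the variables \<open>w\<close>, tending to 0, and \<open>r\<close>, tending
    to \<open>v\<close>, both bounds become functions continuous at the limit point.\<close>
  define w where "w n = 1 / sqrt (real n)" for n
  define r where "r n = real (m n) / sqrt (real n)" for n
  have w: "w \<longlonglongrightarrow> 0" and r: "r \<longlonglongrightarrow> v"
    using inverse_sqrt_tendsto_0 m_ratio unfolding w_def r_def by auto
  define \<epsilon> where "\<epsilon> n = (3 * real (m n) + 2) / (4 * real n + 2 - real (m n))" for n
  have nm: "real n = 1 / (w n)\<^sup>2" "real (m n) = r n / w n" "w n > 0" if "n > 0" for n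
    using that by (auto simp: w_def r_def power_divide)
  have \<epsilon>_eq: "\<epsilon> n = (3 * r n * w n + 2 * (w n)\<^sup>2) / (4 + 2 * (w n)\<^sup>2 - r n * w n)" if "n > 0" for n
  proof -
    have "3 * real (m n) + 2 = (3 * r n * w n + 2 * (w n)\<^sup>2) / (w n)\<^sup>2"
      "4 * real n + 2 - real (m n) = (4 + 2 * (w n)\<^sup>2 - r n * w n) / (w n)\<^sup>2"
      using nm(3)[OF that] by (simp_all add: nm(1,2)[OF that] field_simps power2_eq_square)
    then show ?thesis unfolding \<epsilon>_def using nm(3)[OF that] by simp
  qed
  have T_eq: "(3 * (real (m n))\<^sup>2 + real (m n)) / 2 / (4 * real n + 2 - real (m n)) =
      (3 * (r n)\<^sup>2 + r n * w n) / 2 / (4 + 2 * (w n)\<^sup>2 - r n * w n)"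
    "(3 * (real (m n))\<^sup>2 + real (m n)) / 2 / (4 * real n + 2) =
      (3 * (r n)\<^sup>2 + r n * w n) / 2 / (4 + 2 * (w n)\<^sup>2)" if "n > 0" for n
  proof -
    have "3 * (real (m n))\<^sup>2 + real (m n) = (3 * (r n)\<^sup>2 + r n * w n) / (w n)\<^sup>2"
      "4 * real n + 2 - real (m n) = (4 + 2 * (w n)\<^sup>2 - r n * w n) / (w n)\<^sup>2"
      "4 * real n + 2 = (4 + 2 * (w n)\<^sup>2) / (w n)\<^sup>2"
      using nm(3)[OF that] by (simp_all add: nm(1,2)[OF that] field_simps power2_eq_square)
    then show "(3 * (real (m n))\<^sup>2 + real (m n)) / 2 / (4 * real n + 2 - real (m n)) =
      (3 * (r n)\<^sup>2 + r n * w n) / 2 / (4 + 2 * (w n)\<^sup>2 - r n * w n)"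
    "(3 * (real (m n))\<^sup>2 + real (m n)) / 2 / (4 * real n + 2) =
      (3 * (r n)\<^sup>2 + r n * w n) / 2 / (4 + 2 * (w n)\<^sup>2)" using nm(3)[OF that] by simp_all
  qed
  have lim: "(\<lambda>n. (3 * r n * w n + 2 * (w n)\<^sup>2) / (4 + 2 * (w n)\<^sup>2 - r n * w n)) \<longlonglongrightarrow>
      (3 * v * 0 + 2 * 0\<^sup>2) / (4 + 2 * 0\<^sup>2 - v * 0)"
    by (intro tendsto_intros w r) simp
  have "\<forall>\<^sub>F n in sequentially. (3 * r n * w n + 2 * (w n)\<^sup>2) / (4 + 2 * (w n)\<^sup>2 - r n * w n) = \<epsilon> n"
    using eventually_gt_at_top[of 0] by eventually_elim (simp add: \<epsilon>_eq)
  from Lim_transform_eventually[OF lim this] have \<epsilon>: "\<epsilon> \<longlonglongrightarrow> 0"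
    by simp
  have \<epsilon>_le: "\<forall>\<^sub>F n in sequentially. \<epsilon> n < 1/2"
    using \<epsilon> by (intro order_tendstoD) auto
  show ?thesis
  proof (rule tendsto_sandwich)
    show "\<forall>\<^sub>F n in sequentially. exp (- ((3 * (r n)\<^sup>2 + r n * w n) / 2 / (4 + 2 * (w n)\<^sup>2 - r n * w n) * (1 + 2 * \<epsilon> n))) \<le> binomial_ratio n (m n)"
      using \<epsilon>_le m_eventually_le eventually_gt_at_top[of 0]
    proof eventually_elim
      case (elim n)
      then show ?case
        using binomial_ratio_lower[OF elim(2) \<epsilon>_def] unfolding T_eq(1)[OF elim(3)] by simp
    qed
    show "\<forall>\<^sub>F n in sequentially. binomial_ratio n (m n) \<le> exp (- ((3 * (r n)\<^sup>2 + r n * w n) / 2 / (4 + 2 * (w n)\<^sup>2)))"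
      using m_eventually_le eventually_gt_at_top[of 0]
      by eventually_elim (simp only: binomial_ratio_upper T_eq(2)[symmetric])
    have "(\<lambda>n. exp (- ((3 * (r n)\<^sup>2 + r n * w n) / 2 / (4 + 2 * (w n)\<^sup>2 - r n * w n) * (1 + 2 * \<epsilon> n)))) \<longlonglongrightarrow>
      exp (- ((3 * v\<^sup>2 + v * 0) / 2 / (4 + 2 * 0\<^sup>2 - v * 0) * (1 + 2 * 0)))"
      by (intro tendsto_intros w r \<epsilon>) auto
    then show "(\<lambda>n. exp (- ((3 * (r n)\<^sup>2 + r n * w n) / 2 / (4 + 2 * (w n)\<^sup>2 - r n * w n) * (1 + 2 * \<epsilon> n)))) \<longlonglongrightarrow>
      exp (- (3/8 * v\<^sup>2))" by simp
    have "(\<lambda>n. exp (- ((3 * (r n)\<^sup>2 + r n * w n) / 2 / (4 + 2 * (w n)\<^sup>2)))) \<longlonglongrightarrow>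
      exp (- ((3 * v\<^sup>2 + v * 0) / 2 / (4 + 2 * 0\<^sup>2)))"
      by (intro tendsto_intros w r) auto
    then show "(\<lambda>n. exp (- ((3 * (r n)\<^sup>2 + r n * w n) / 2 / (4 + 2 * (w n)\<^sup>2)))) \<longlonglongrightarrow> exp (- (3/8 * v\<^sup>2))" by simp
  qed
qed

end

section \<open>Dominated convergence for the normalised area sum\<close>

definition area_term :: "nat \<Rightarrow> nat \<Rightarrow> real" where
  "area_term n m = (if 1 \<le> m \<and> m \<le> n then
     catalan m / 4 ^ m * (real (3 * m + 2) / real (4 * n - m + 2)) * binomial_ratio n m else 0)"

text \<open>Every factor on the right has a limit when \<open>m\<close> is about
  \<open>v * sqrt n\<close>: m^(-3/2) from the Catalan number, m from \<open>3 * m + 2\<close> and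
  1/n combine to (m / sqrt n)^(-1/2) n^(-5/4).\<close>

lemma area_term_rescaled:
  assumes "1 \<le> m" "m \<le> n"
  shows "real n powr (5/4) * area_term n m = (catalan m / 4 ^ m * real m powr (3/2)) * (real (3 * m + 2) / real m) *
    (real n / real (4 * n - m + 2)) * (real m / sqrt (real n)) powr (-1/2) * binomial_ratio n m"
proof -
  have n: "n \<ge> 1" using assms by simp
  have "(real m / sqrt (real n)) powr (-1/2) = real m powr (-1/2) / sqrt (real n) powr (-1/2)"
    by (simp add: powr_divide)
  also have "sqrt (real n) powr (-1/2) = real n powr (-1/4)"
    using n by (simp add: powr_half_sqrt[symmetric] powr_powr)
  also have "real m powr (-1/2) / real n powr (-1/4) = real m powr (-1/2) * real n powr (1/4)"
    using powr_minus_divide[of "real n" "1/4"] by simp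
  finally have *: "(real m / sqrt (real n)) powr (-1/2) = real m powr (-1/2) * real n powr (1/4)" .
  have m1: "real m powr (3/2) * real m powr (-1/2) = real m"
    using assms by (simp flip: powr_add)
  have n1: "real n powr (5/4) = real n * real n powr (1/4)"
    using n powr_mult_base[of "real n" "1/4"] by simp
  have "(catalan m / 4 ^ m * real m powr (3/2)) * (real (3 * m + 2) / real m) *
    (real n / real (4 * n - m + 2)) * (real m powr (-1/2) * real n powr (1/4)) * binomial_ratio n m =
    (real m powr (3/2) * real m powr (-1/2)) / real m * (real n * real n powr (1/4)) *
    (catalan m / 4 ^ m * (real (3 * m + 2) / real (4 * n - m + 2)) * binomial_ratio n m)"
    by (simp only: divide_inverse ac_simps)
  also have "\<dots> = real n powr (5/4) * area_term n m"
    unfolding m1 n1 using assms by (simp add: area_term_def)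
  finally show ?thesis unfolding * ..
qed

lemma scaled_area_limit:
  assumes "v > 0"
  shows "(\<lambda>n. real n powr (5/4) * area_term n (nat \<lceil>v * sqrt (real n)\<rceil>)) \<longlonglongrightarrow>
    3 / (4 * sqrt pi) * (v powr (-1/2) * exp (- (3/8 * v\<^sup>2)))"
proof -
  define m where "m n = nat \<lceil>v * sqrt (real n)\<rceil>" for n
  note lims = m_ratio[OF assms m_def] m_at_top[OF assms m_def] m_eventually_le[OF assms m_def] binomial_ratio_limit[OF assms m_def]
  have "(\<lambda>n. catalan (m n) / 4 ^ m n * real (m n) powr (3/2)) \<longlonglongrightarrow> 1 / sqrt pi"
    by (rule filterlim_compose[OF catalan_asymp lims(2)])
  moreover have "(\<lambda>n. real (3 * m n + 2) / real (m n)) \<longlonglongrightarrow> 3"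
  proof (rule filterlim_compose[OF _ lims(2)])
    show "(\<lambda>k. real (3 * k + 2) / real k) \<longlonglongrightarrow> 3" by real_asymp
  qed
  moreover have "(\<lambda>n. real n / real (4 * n - m n + 2)) \<longlonglongrightarrow> 1 / 4"
  proof -
    have lim: "(\<lambda>n. 1 / (4 - real (m n) / sqrt (real n) * (1 / sqrt (real n)) + 2 / real n)) \<longlonglongrightarrow> 1 / (4 - v * 0 + 0)"
      by (intro tendsto_intros lims(1)) (real_asymp | simp)+
    have "\<forall>\<^sub>F n in sequentially. 1 / (4 - real (m n) / sqrt (real n) * (1 / sqrt (real n)) + 2 / real n) = real n / real (4 * n - m n + 2)"
      using lims(3) eventually_gt_at_top[of 0]
    proof eventually_elim
      case (elim n)
      then have "4 - real (m n) / sqrt (real n) * (1 / sqrt (real n)) + 2 / real n = real (4 * n - m n + 2) / real n"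
        by (simp add: field_simps of_nat_diff)
      then show ?case by simp
    qed
    from Lim_transform_eventually[OF lim this] show ?thesis by simp
  qed
  moreover have "(\<lambda>n. (real (m n) / sqrt (real n)) powr (-1/2)) \<longlonglongrightarrow> v powr (-1/2)"
    by (intro tendsto_intros lims(1)) (use assms in auto)
  ultimately have lim: "(\<lambda>n. (catalan (m n) / 4 ^ m n * real (m n) powr (3/2)) * (real (3 * m n + 2) / real (m n)) *
    (real n / real (4 * n - m n + 2)) * (real (m n) / sqrt (real n)) powr (-1/2) * binomial_ratio n (m n)) \<longlonglongrightarrow>
    1 / sqrt pi * 3 * (1/4) * v powr (-1/2) * exp (- (3/8 * v\<^sup>2))"
    by (intro tendsto_mult lims(4))
  have "\<forall>\<^sub>F n in sequentially. m n \<ge> 1"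
    using lims(2) by (simp add: filterlim_at_top)
  then have "\<forall>\<^sub>F n in sequentially. (catalan (m n) / 4 ^ m n * real (m n) powr (3/2)) * (real (3 * m n + 2) / real (m n)) *
    (real n / real (4 * n - m n + 2)) * (real (m n) / sqrt (real n)) powr (-1/2) * binomial_ratio n (m n) = real n powr (5/4) * area_term n (m n)"
    using lims(3) by eventually_elim (simp only: area_term_rescaled)
  from Lim_transform_eventually[OF lim this] show ?thesis unfolding m_def by (simp add: mult.assoc mult.commute[of 4])
qed

text \<open>The ceiling rounds up, so \<open>v \<le> m / sqrt n\<close>, and the decreasing
  functions of \<open>m / sqrt n\<close> may be evaluated at \<open>v\<close>. The constant 5 bounds
  \<open>(3 * m + 2) / m\<close>.\<close>

lemma scaled_area_bound:
  obtains K where "\<And>n v. n \<ge> 1 \<Longrightarrow> v > 0 \<Longrightarrow>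
    norm (real n powr (5/4) * area_term n (nat \<lceil>v * sqrt (real n)\<rceil>)) \<le> K * (v powr (-1/2) * exp (- (1/4 * v\<^sup>2)))"
proof -
  have "Bseq (\<lambda>m. catalan m / 4 ^ m * real m powr (3/2))"
    using catalan_asymp by (intro convergent_imp_Bseq convergentI)
  then obtain K where K: "K > 0" "\<And>m. norm (catalan m / 4 ^ m * real m powr (3/2)) \<le> K"
    by (auto elim: BseqE)
  have "norm (real n powr (5/4) * area_term n (nat \<lceil>v * sqrt (real n)\<rceil>)) \<le> K * 5 * (v powr (-1/2) * exp (- (1/4 * v\<^sup>2)))"
    if n: "n \<ge> 1" and v: "v > 0" for n v
  proof -
    define m where "m = nat \<lceil>v * sqrt (real n)\<rceil>"
    have mv: "v \<le> real m / sqrt (real n)"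
      unfolding m_def by (rule m_ratio_ge[OF v refl n])
    show ?thesis
    proof (cases "1 \<le> m \<and> m \<le> n")
      case False
      then show ?thesis using K(1) unfolding m_def[symmetric] by (auto simp: area_term_def)
    next
      case True
      then have m: "1 \<le> m" "m \<le> n" by auto
      have "binomial_ratio n m \<ge> 0" by (simp add: binomial_ratio_def)
      have "catalan m \<ge> 0" by (simp add: catalan_def)
      have "binomial_ratio n m \<le> exp (- ((3 * (real m)\<^sup>2 + real m) / 2 / (4 * real n + 2)))"
        by (rule binomial_ratio_upper[OF m(2)])
      also have "\<dots> \<le> exp (- (1/4 * v\<^sup>2))"
      proof -
        have "v\<^sup>2 \<le> (real m / sqrt (real n))\<^sup>2" using mv v by (intro power_mono) auto
        then have "v\<^sup>2 * real n \<le> (real m)\<^sup>2" using n by (simp add: power_divide field_simps)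
        \<comment> \<open>The rate 1/4 instead of 3/8 is the price of
          \<open>4 * n + 2 \<le> 6 * n\<close>, which makes the bound uniform in
          \<open>n\<close>.\<close>
        then have "1/4 * v\<^sup>2 \<le> (3 * (real m)\<^sup>2) / 2 / (6 * real n)" using n by (simp add: field_simps)
        also have "\<dots> \<le> (3 * (real m)\<^sup>2 + real m) / 2 / (4 * real n + 2)"
          using n by (intro frac_le) auto
        finally show ?thesis by simp
      qed
      finally have R: "binomial_ratio n m \<le> exp (- (1/4 * v\<^sup>2))" .
      have "norm (real n powr (5/4) * area_term n m) = (catalan m / 4 ^ m * real m powr (3/2)) * (real (3 * m + 2) / real m) *
        (real n / real (4 * n - m + 2)) * (real m / sqrt (real n)) powr (-1/2) * binomial_ratio n m"
        unfolding area_term_rescaled[OF m] using \<open>binomial_ratio n m \<ge> 0\<close> \<open>catalan m \<ge> 0\<close>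
        by (simp add: abs_mult)
      also have "\<dots> \<le> K * 5 * 1 * v powr (-1/2) * exp (- (1/4 * v\<^sup>2))"
      proof (intro mult_mono)
        show "catalan m / 4 ^ m * real m powr (3/2) \<le> K" using K(2)[of m] abs_ge_self order_trans unfolding real_norm_def by blast
        show "real (3 * m + 2) / real m \<le> 5" using m by (simp add: field_simps)
        show "real n / real (4 * n - m + 2) \<le> 1" using m by (simp add: field_simps of_nat_diff)
        show "(real m / sqrt (real n)) powr (-1/2) \<le> v powr (-1/2)"
          using mv v by (intro powr_mono2') auto
      qed (use R K(1) \<open>binomial_ratio n m \<ge> 0\<close> \<open>catalan m \<ge> 0\<close> in auto)
      finally show ?thesis unfolding m_def by (simp add: mult.assoc)
    qed
  qed
  then show ?thesis using that by blast
qed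

text \<open>
  The sum is the integral of a step function in \<open>v = m / sqrt n\<close>, to which dominated convergence applies.
\<close>

lemma area_sum_limit:
  "(\<lambda>n. real n powr (3/4) * (\<Sum>m=1..n. area_term n m)) \<longlonglongrightarrow>
    3 / (4 * sqrt pi) * (Gamma (1/4) / (2 * (3/8) powr (1/4)))"
proof -
  define F where "F n v = real n powr (5/4) * area_term n (nat \<lceil>v * sqrt (real n)\<rceil>)" for n v
  obtain K where K: "\<And>n v. n \<ge> 1 \<Longrightarrow> v > 0 \<Longrightarrow> norm (F n v) \<le> K * (v powr (-1/2) * exp (- (1/4 * v\<^sup>2)))"
    unfolding F_def using scaled_area_bound by blast
  have int: "(F n has_integral real n powr (3/4) * (\<Sum>m=1..n. area_term n m)) {0<..}" if "n \<ge> 1" for n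
  proof -
    have "(F n has_integral real n powr (5/4) * ((\<Sum>m=1..n. area_term n m) / sqrt (real n))) {0<..}"
      unfolding F_def using that
      by (intro has_integral_mult_right has_integral_step_function) (auto simp: area_term_def)
    moreover have "real n powr (5/4) = real n powr (3/4) * sqrt (real n)"
      using that by (simp add: powr_half_sqrt[symmetric] flip: powr_add)
    ultimately show ?thesis using that by simp
  qed
  \<comment> \<open>The index is shifted because the majorant must hold for every member of the
    sequence, and \<open>K\<close> requires \<open>n \<ge> 1\<close>.\<close>
  have "(\<lambda>n. integral {0<..} (F (Suc n))) \<longlonglongrightarrow>
      integral {0<..} (\<lambda>v. 3 / (4 * sqrt pi) * (v powr (-1/2) * exp (- (3/8 * v\<^sup>2))))"
  proof (rule dominated_convergence(2))
    show "F (Suc n) integrable_on {0<..}" for n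
      using int[of "Suc n"] by auto
    show "(\<lambda>v. K * (v powr (-1/2) * exp (- (1/4 * v\<^sup>2)))) integrable_on {0<..}"
      using has_integral_powr_exp_square[of "1/4"] by (intro integrable_on_mult_right) auto
    show "norm (F (Suc n) v) \<le> K * (v powr (-1/2) * exp (- (1/4 * v\<^sup>2)))" if "v \<in> {0<..}" for n v
      using that by (intro K) auto
    show "(\<lambda>n. F (Suc n) v) \<longlonglongrightarrow> 3 / (4 * sqrt pi) * (v powr (-1/2) * exp (- (3/8 * v\<^sup>2)))" if "v \<in> {0<..}" for v
      unfolding F_def using that by (intro LIMSEQ_Suc scaled_area_limit) auto
  qed
  moreover have "integral {0<..} (F (Suc n)) = real (Suc n) powr (3/4) * (\<Sum>m=1..Suc n. area_term (Suc n) m)" for n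
    using int[of "Suc n"] by (intro integral_unique) simp
  moreover have "integral {0<..} (\<lambda>v. 3 / (4 * sqrt pi) * (v powr (-1/2) * exp (- (3/8 * v\<^sup>2)))) =
      3 / (4 * sqrt pi) * (Gamma (1/4) / (2 * (3/8) powr (1/4)))"
    by (intro integral_unique has_integral_mult_right has_integral_powr_exp_square) simp
  ultimately have "(\<lambda>n. real (Suc n) powr (3/4) * (\<Sum>m=1..Suc n. area_term (Suc n) m)) \<longlonglongrightarrow>
      3 / (4 * sqrt pi) * (Gamma (1/4) / (2 * (3/8) powr (1/4)))"
    by simp
  then show ?thesis by (rule LIMSEQ_imp_Suc)
qed

section \<open>The constant and the final quotient\<close>

lemma limit_constant:
  "2 * (3 / (4 * sqrt pi) * (Gamma (1/4) / (2 * (3/8) powr (1/4)))) =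
    2 powr (1/4) * 3 powr (3/4) * sqrt pi / (2 * Gamma (3/4 :: real))"
proof -
  have G: "Gamma (1/4 :: real) = pi * sqrt 2 / Gamma (3/4)"
  proof -
    have "Gamma (3/4 :: real) \<noteq> 0" by (rule less_imp_neq[symmetric], rule Gamma_real_pos) simp
    then show ?thesis using Gamma_quarter by (simp add: eq_divide_eq)
  qed
  have "(3/8 :: real) powr (1/4) = 3 powr (1/4) / 8 powr (1/4)" by (simp add: powr_divide)
  also have "(8 :: real) powr (1/4) = 2 powr (3/4)"
    using powr_powr[of 2 3 "1/4 :: real"] by (simp add: powr_numeral)
  finally have p: "(3/8 :: real) powr (1/4) = 3 powr (1/4) / 2 powr (3/4)" .
  have t: "(3 :: real) = 3 powr (3/4) * 3 powr (1/4)" by (simp flip: powr_add)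
  have w: "2 powr (3/4) * sqrt 2 = 2 * (2 :: real) powr (1/4)"
  proof -
    have "2 powr (3/4) * sqrt 2 = (2 :: real) powr (3/4 + 1/2)"
      by (simp only: powr_add powr_half_sqrt)
    also have "\<dots> = 2 powr (1 + 1/4)" by simp
    also have "\<dots> = 2 * (2 :: real) powr (1/4)" by (simp only: powr_add) simp
    finally show ?thesis .
  qed
  have "2 * (3 / (4 * sqrt pi) * (Gamma (1/4) / (2 * (3/8) powr (1/4)))) =
      (3 / 3 powr (1/4)) * (pi / sqrt pi) * (2 powr (3/4) * sqrt 2) / (4 * Gamma (3/4))"
    unfolding G p by (simp add: ac_simps)
  also have "3 / 3 powr (1/4) = (3 :: real) powr (3/4)"
    by (subst (1) t) simp
  also have "pi / sqrt pi = sqrt pi" by (simp add: real_div_sqrt)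
  finally show ?thesis unfolding w by simp
qed

lemma mean_area_asymp:
  fixes A H :: "nat \<Rightarrow> real"
  assumes A: "\<And>n. n \<ge> 1 \<Longrightarrow> A n = (\<Sum>m=1..n. real ((2 * m + 1) choose m) / real (2 * m + 1) *
       (real (3 * m + 2) / real (4 * n - m + 2) * real ((4 * n - m + 2) choose (n - m))))"
    and H: "\<And>n. n \<ge> 1 \<Longrightarrow> H n = 4 / real (4 * n + 2) * real ((4 * n + 2) choose n)
     - 3 / real (4 * n + 3) * real ((4 * n + 3) choose n)"
  shows "(\<lambda>n. A n / H n) \<sim>[sequentially]
    (\<lambda>n. 2 powr (1/4) * 3 powr (3/4) * sqrt pi / (2 * Gamma (3/4)) * real n powr (5/4))"
proof -
  define L where "L = 3 / (4 * sqrt pi) * (Gamma (1/4) / (2 * (3/8) powr (1/4)))"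
  have ratio: "A n / H n = (\<Sum>m=1..n. area_term n m) * ((2 * real n + 1) * (real n + 1))" if "n \<ge> 1" for n
  proof -
    define B where "B = real ((4 * n + 2) choose n)"
    have B: "B > 0" unfolding B_def by (simp add: zero_less_binomial del: binomial_Suc_Suc)
    have "A n = B * (\<Sum>m=1..n. area_term n m)"
      unfolding A[OF that] sum_distrib_left
      by (rule sum.cong) (use B in \<open>auto simp: area_term_def catalan_def binomial_ratio_def B_def[symmetric] simp del: binomial_Suc_Suc add_2_eq_Suc' add_2_eq_Suc\<close>)
    \<comment> \<open>Since (4n+3 choose n) = (4n+3)/(3n+3) * B, this is B * (2/(2n+1) - 1/(n+1)).
      The terms of order 1/n cancel, which leaves B / (2 n^2) to leading order and explains the
      factor 2 in front of \<open>L\<close>.\<close>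
    moreover have "H n = B / ((2 * real n + 1) * (real n + 1))"
    proof -
      have "(3 * n + 3) * ((4 * n + 3) choose n) = (4 * n + 3) * ((4 * n + 2) choose n)"
        using binomial_absorb_comp[of "4 * n + 3" n] by (simp add: eval_nat_numeral)
      then have "real (3 * n + 3) * real ((4 * n + 3) choose n) = real (4 * n + 3) * B"
        unfolding B_def by (metis of_nat_mult)
      then have "real ((4 * n + 3) choose n) = real (4 * n + 3) * B / real (3 * n + 3)"
        by (simp add: field_simps del: binomial_Suc_Suc)
      then have "H n = 4 / real (4 * n + 2) * B - 3 / real (4 * n + 3) * (real (4 * n + 3) * B / real (3 * n + 3))"
        using H[OF that] by (simp only: B_def)
      also have "\<dots> = B / ((2 * real n + 1) * (real n + 1))"
        by (simp add: divide_simps) (simp add: algebra_simps)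
      finally show ?thesis .
    qed
    ultimately show ?thesis using B by simp
  qed
  have "(\<lambda>n. (real n powr (3/4) * (\<Sum>m=1..n. area_term n m)) * ((2 * real n + 1) * (real n + 1) / (real n)\<^sup>2)) \<longlonglongrightarrow> L * 2"
  proof (rule tendsto_mult)
    show "(\<lambda>n. (2 * real n + 1) * (real n + 1) / (real n)\<^sup>2) \<longlonglongrightarrow> 2" by real_asymp
  qed (use area_sum_limit in \<open>simp add: L_def\<close>)
  moreover have "\<forall>\<^sub>F n in sequentially. (real n powr (3/4) * (\<Sum>m=1..n. area_term n m)) *
      ((2 * real n + 1) * (real n + 1) / (real n)\<^sup>2) = A n / H n / real n powr (5/4)"
    using eventually_ge_at_top[of 1]
  proof eventually_elim
    case (elim n)
    have "(real n)\<^sup>2 = real n powr (5/4) * real n powr (3/4)"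
      using elim by (simp flip: powr_add powr_numeral)
    then show ?case using elim unfolding ratio[OF elim] by simp
  qed
  ultimately have "(\<lambda>n. A n / H n / real n powr (5/4)) \<longlonglongrightarrow> 2 * L"
    by (auto intro: Lim_transform_eventually simp: mult.commute)
  moreover have "Gamma (1/4 :: real) \<noteq> 0" by (rule less_imp_neq[symmetric], rule Gamma_real_pos) simp
  then have "L \<noteq> 0" by (simp add: L_def)
  ultimately have "(\<lambda>n. A n / H n / real n powr (5/4) / (2 * L)) \<longlonglongrightarrow> 2 * L / (2 * L)"
    by (intro tendsto_divide tendsto_const) auto
  then have "(\<lambda>n. A n / H n) \<sim>[sequentially] (\<lambda>n. 2 * L * real n powr (5/4))"
    using \<open>L \<noteq> 0\<close> by (intro asymp_equivI') (simp add: divide_divide_eq_left ac_simps)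
  then show ?thesis unfolding L_def limit_constant .
qed

theorem theorem5:
  shows "(\<forall>n\<ge>1. (\<Sum>F\<in>EF n. real_of_int (area F)) / real (card (EF n))
            = fps_nth area_gf n / fps_nth fish_gf n)
       \<and> (\<lambda>n. (\<Sum>F\<in>EF n. real_of_int (area F)) / real (card (EF n)))
           \<sim>[sequentially]
         (\<lambda>n. 2 powr (1/4) * 3 powr (3/4) * sqrt pi / (2 * Gamma (3/4)) * real n powr (5/4))"
proof
  show "\<forall>n\<ge>1. (\<Sum>F\<in>EF n. real_of_int (area F)) / real (card (EF n)) = fps_nth area_gf n / fps_nth fish_gf n"
    by (simp add: area_gf_def fish_gf_def)
  show "(\<lambda>n. (\<Sum>F\<in>EF n. real_of_int (area F)) / real (card (EF n))) \<sim>[sequentially]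
      (\<lambda>n. 2 powr (1/4) * 3 powr (3/4) * sqrt pi / (2 * Gamma (3/4)) * real n powr (5/4))"
    by (rule mean_area_asymp) (simp_all only: sum_area_EF card_EF sum_area_trees card_trees)
qed

end
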